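(* Let $A\in\mathbb{C}^{n\times n}$ be a positive-semidefinite matrix, let $P\in\{0,1\}^{n\times n}$ be a permutation matrix, and let $(S_i)_{i=1}^n$ be a sparsity pattern ($S_i\subseteq\{1,\ldots,i-1\}$). Let $\hat A = P\hat C^{-1}\hat D\hat C^{-*}P^*$ be the Vecchia approximation of $A$ with permutation $P$ and sparsity pattern $(S_i)_{i=1}^n$. Then $\hat A$ achieves the smallest possible Kaporin condition number $\kappa_{\rm Kap}$ (with respect to the target $A$) among all inverse Cholesky approximations with permutation $P$ and sparsity pattern $(S_i)_{i=1}^n$. Moreover, if the Vecchia approximation $\hat A$ has the same range as $A$, its Kaporin condition number is $$\kappa_{\rm Kap} = \prod_{i\,:\,d_{\tilde A}(e_i,\operatorname{span}\{e_j\}_{j<i})>0}\frac{d_{\tilde A}\bigl(e_i,\operatorname{span}\{e_j\}_{j\in S_i}\bigr)^2}{d_{\tilde A}\bigl(e_i,\operatorname{span}\{e_j\}_{j<i}\bigr)^2},\qquad \tilde A = P^*AP.$$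
   Context: Positive-semidefinite matrices are Hermitian; $M^*$ is the conjugate transpose, $M^{-*}=(M^{-1})^*$, $M^+$ is the Moore–Penrose pseudoinverse, and $e_i$ is the $i$th standard basis vector. For index sets $S,T$, $M(S,T)$ denotes the corresponding submatrix. Weighted distance: for positive-semidefinite $M$, $d_M(u,v)=[(u-v)^*M(u-v)]^{1/2}$ and $d_M(u,V)=\inf_{v\in V}d_M(u,v)$ for a set of vectors $V$. The span of the empty set is $\{0\}$. Volume: $\operatorname{vol}(M)$ is the product of the positive eigenvalues of $M$ (with multiplicity). Kaporin condition number: for positive-semidefinite $A,\hat A\in\mathbb{C}^{n\times n}$ with the same range and $r=\operatorname{rank}(A)$, $$\kappa_{\rm Kap}=\frac{\bigl(\frac1r\operatorname{tr}(A\hat A^+)\bigr)^r}{\operatorname{vol}(A\hat A^+)};$$ if $A$ and $\hat A$ have different ranges, $\kappa_{\rm Kap}=\infty$. Inverse Cholesky approximation with permutation $P$ and sparsity pattern $(S_i)_{i=1}^n$: any matrix $\hat A=P\hat C^{-1}\hat D\hat C^{-*}P^*$ with $\hat D$ diagonal with nonnegative entries and $\hat C$ lower triangular with ones on the diagonal whose off-diagonal entries in row $i$ vanish outside columns $S_i$, for each $i$. Vecchia approximation of $A$ with permutation $P$ and sparsity pattern $(S_i)_{i=1}^n$: an inverse Cholesky approximation $\hat A=P\hat C^{-1}\hat D\hat C^{-*}P^*$ with permutation $P$ and sparsity pattern $(S_i)_{i=1}^n$ (that is, $\hat D$ is diagonal with nonnegative entries and $\hat C$ is lower triangular with ones on the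 diagonal and with off-diagonal entries in row $i$ vanishing outside columns $S_i$, for each $i$) that satisfies, for every $i=1,\ldots,n$, with $\tilde A=P^*AP$, $$\begin{bmatrix}\hat C(i,S_i) & 1\end{bmatrix}\begin{bmatrix}\tilde A(S_i,S_i) & \tilde A(S_i,i)\\ \tilde A(i,S_i) & \tilde A(i,i)\end{bmatrix} = \begin{bmatrix}0 & \hat D(i,i)\end{bmatrix}.$$ *)

theory Defs
  imports
    "HOL-Library.Extended_Real"
    "Jordan_Normal_Form.Char_Poly"
    "Jordan_Normal_Form.DL_Rank"
    "Jordan_Normal_Form.Schur_Decomposition"
    "Jordan_Normal_Form.Gauss_Jordan_Elimination"
begin

text \<open>
  Indices run over \<open>{0..<n}\<close>. The order on complex numbers is the one of
  \<^theory>\<open>HOL-Library.Complex_Order\<close>: \<open>0 \<le> z\<close> says that \<open>z\<close> is real and nonnegative.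
  The conjugate transpose \<open>M\<^sup>*\<close> is \<^const>\<open>mat_adjoint\<close>, and \<open>(M *\<^sub>v v) \<bullet>c v\<close> is \<open>v\<^sup>* M v\<close>.
\<close>

definition psd_mat :: "nat \<Rightarrow> complex mat \<Rightarrow> bool" where
  "psd_mat n M \<longleftrightarrow> M \<in> carrier_mat n n \<and> mat_adjoint M = M \<and>
     (\<forall>v \<in> carrier_vec n. 0 \<le> (M *\<^sub>v v) \<bullet>c v)"

definition perm_mat :: "nat \<Rightarrow> complex mat \<Rightarrow> bool" where
  "perm_mat n P \<longleftrightarrow> P \<in> carrier_mat n n \<and>
     (\<forall>i<n. \<forall>j<n. P $$ (i, j) \<in> {0, 1}) \<and>
     (\<forall>i<n. \<exists>!j. j < n \<and> P $$ (i, j) = 1) \<and>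
     (\<forall>j<n. \<exists>!i. i < n \<and> P $$ (i, j) = 1)"

definition sparsity_pattern :: "nat \<Rightarrow> (nat \<Rightarrow> nat set) \<Rightarrow> bool" where
  "sparsity_pattern n S \<longleftrightarrow> (\<forall>i<n. S i \<subseteq> {0..<i})"

definition mat_trace :: "complex mat \<Rightarrow> complex" where
  "mat_trace M = (\<Sum>i = 0..<dim_row M. M $$ (i, i))"

definition mat_range :: "complex mat \<Rightarrow> complex vec set" where
  "mat_range M = (\<lambda>v. M *\<^sub>v v) ` carrier_vec (dim_col M)"

definition is_pinv :: "complex mat \<Rightarrow> complex mat \<Rightarrow> bool" where
  "is_pinv M X \<longleftrightarrow> X \<in> carrier_mat (dim_col M) (dim_row M) \<and>
     M * X * M = M \<and> X * M * X = X \<and>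
     mat_adjoint (M * X) = M * X \<and> mat_adjoint (X * M) = X * M"

definition pinv :: "complex mat \<Rightarrow> complex mat" where
  "pinv M = (THE X. is_pinv M X)"

text \<open>Each positive eigenvalue is counted with its algebraic multiplicity, the order of the
  corresponding root of the characteristic polynomial. The argument need not be Hermitian.\<close>

definition mat_vol :: "complex mat \<Rightarrow> real" where
  "mat_vol M = (\<Prod>a \<in> {a. eigenvalue M a \<and> 0 < a}. Re a ^ Polynomial.order a (char_poly M))"

text \<open>Meant for positive-semidefinite \<open>A\<close> and \<open>B\<close> of the same size, for which the trace of
  \<open>A B\<^sup>+\<close> is real. For rank \<open>0\<close> the conventions \<open>x / 0 = 0\<close> and \<open>0 ^ 0 = 1\<close> give the value \<open>1\<close>.\<close>

definition kaporin :: "complex mat \<Rightarrow> complex mat \<Rightarrow> ereal" where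
  "kaporin A B =
     (if mat_range A = mat_range B
      then let r = vec_space.rank (dim_row A) A
           in ereal ((Re (mat_trace (A * pinv B)) / real r) ^ r / mat_vol (A * pinv B))
      else \<infinity>)"

definition mat_dist :: "complex mat \<Rightarrow> complex vec \<Rightarrow> complex vec \<Rightarrow> real" where
  "mat_dist M u v = sqrt (Re ((M *\<^sub>v (u - v)) \<bullet>c (u - v)))"

definition mat_setdist :: "complex mat \<Rightarrow> complex vec \<Rightarrow> complex vec set \<Rightarrow> real" where
  "mat_setdist M u V = (INF v \<in> V. mat_dist M u v)"

text \<open>The linear span in \<open>\<complex>\<^sup>n\<close>; this is \<open>span\<close> of the locale \<^locale>\<open>vec_space\<close>.\<close>

definition cspan :: "nat \<Rightarrow> complex vec set \<Rightarrow> complex vec set" where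
  "cspan n = LinearCombinations.module.span class_ring (module_vec TYPE(complex) n)"

definition inv_chol_factors ::
    "nat \<Rightarrow> (nat \<Rightarrow> nat set) \<Rightarrow> complex mat \<Rightarrow> complex mat \<Rightarrow> bool" where
  "inv_chol_factors n S C D \<longleftrightarrow>
     C \<in> carrier_mat n n \<and>
     (\<forall>i<n. C $$ (i, i) = 1) \<and>
     (\<forall>i<n. \<forall>j<n. i < j \<longrightarrow> C $$ (i, j) = 0) \<and>
     (\<forall>i<n. \<forall>j<n. j \<noteq> i \<and> j \<notin> S i \<longrightarrow> C $$ (i, j) = 0) \<and>
     D \<in> carrier_mat n n \<and> diagonal_mat D \<and> (\<forall>i<n. 0 \<le> D $$ (i, i))"

text \<open>\<open>P C\<^sup>-\<^sup>1 D C\<^sup>-\<^sup>* P\<^sup>*\<close>; a unit lower triangular \<open>C\<close> is invertible, so \<^const>\<open>mat_inverse\<close>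
  yields its inverse.\<close>

definition inv_chol_mat :: "complex mat \<Rightarrow> complex mat \<Rightarrow> complex mat \<Rightarrow> complex mat" where
  "inv_chol_mat P C D =
     (let Ci = the (mat_inverse C) in P * Ci * D * mat_adjoint Ci * mat_adjoint P)"

definition inverse_cholesky_approx ::
    "nat \<Rightarrow> complex mat \<Rightarrow> (nat \<Rightarrow> nat set) \<Rightarrow> complex mat \<Rightarrow> bool" where
  "inverse_cholesky_approx n P S B \<longleftrightarrow>
     (\<exists>C D. inv_chol_factors n S C D \<and> B = inv_chol_mat P C D)"

text \<open>The last two conjuncts are the columns \<open>S i\<close> and \<open>i\<close> of the block equation
  \<open>[C(i,S\<^sub>i) 1] [T(S\<^sub>i,S\<^sub>i) T(S\<^sub>i,i); T(i,S\<^sub>i) T(i,i)] = [0 D(i,i)]\<close> with \<open>T = P\<^sup>* A P\<close>.\<close>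

definition vecchia_approx ::
    "nat \<Rightarrow> complex mat \<Rightarrow> complex mat \<Rightarrow> (nat \<Rightarrow> nat set) \<Rightarrow> complex mat \<Rightarrow> bool" where
  "vecchia_approx n A P S B \<longleftrightarrow>
     (let T = mat_adjoint P * A * P in
      \<exists>C D. inv_chol_factors n S C D \<and> B = inv_chol_mat P C D \<and>
        (\<forall>i<n. (\<forall>j \<in> S i. (\<Sum>k \<in> S i. C $$ (i, k) * T $$ (k, j)) + T $$ (i, j) = 0) \<and>
               (\<Sum>k \<in> S i. C $$ (i, k) * T $$ (k, i)) + T $$ (i, i) = D $$ (i, i)))"

end

theory Submission
  imports Defs "HOL-Analysis.Convex"
begin

text \<open>
  Write \<open>T = P\<^sup>* A P\<close> and let \<open>pivot i\<close> be the squared \<open>T\<close>-distance of \<open>e\<^sub>i\<close> to the span of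
  all earlier unit vectors, \<open>sparse_var i\<close> the squared distance to the span of those in
  \<open>S i\<close>; clearly \<open>pivot i \<le> sparse_var i\<close>. Gram--Schmidt in the seminorm of \<open>T\<close> yields the
  Cholesky factorization of \<open>T\<close> with the pivots \<open>pivot i\<close>. For an approximation with factors
  \<open>C, D\<close> everything is expressed by the Gram matrix \<open>M = C T C\<^sup>*\<close> of the rows of \<open>C\<close>.

  Let \<open>B\<close> be an approximation with the range of \<open>A\<close>. Moving factors cyclically shows that
  \<open>A B\<^sup>+\<close> has the same trace and the same characteristic polynomial as \<open>M D\<^sup>+\<close>
  (\<open>pinv_replace\<close>, \<open>kaporin_congruence\<close>). Moreover, \<open>D\<close> and the pivots have the same support
  \<open>Supp\<close> (\<open>support_eq\<close>). The trace is then the sum of \<open>M (i, i) / D (i, i)\<close> over \<open>Supp\<close>. The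
  volume is a determinant once the zero eigenvalues have been replaced by ones
  (\<open>vol_eq_det\<close>), and since unit triangular factors have determinant one it equals the
  product of \<open>pivot i / D (i, i)\<close> over \<open>Supp\<close>. The inequality between arithmetic and
  geometric mean now eliminates \<open>D\<close> and bounds the Kaporin number below by the product of
  \<open>M (i, i) / pivot i\<close>. Row \<open>i\<close> of \<open>C\<close> differs from \<open>e\<^sub>i\<close> only at positions in \<open>S i\<close>, so
  \<open>M (i, i) \<ge> sparse_var i\<close>, which makes the product of \<open>sparse_var i / pivot i\<close> a lower
  bound for every approximation with the range of \<open>A\<close>.

  The Vecchia equations are the normal equations of the projection of \<open>e\<^sub>i\<close> onto the span of
  the unit vectors in \<open>S i\<close>, hence \<open>M (i, i) = D (i, i) = sparse_var i\<close>. All the ratios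
  \<open>M (i, i) / D (i, i)\<close> are equal to one and the bound is attained, provided that the range
  is right. If the Vecchia approximation misses the range of \<open>A\<close>, its Kaporin number is
  infinite, but then so is that of every competitor: a competitor with the right range forces
  \<open>sparse_var i = 0\<close> wherever \<open>pivot i = 0\<close>, and this already gives the Vecchia approximation
  the right range (\<open>vecchia_range\<close>).
\<close>

section \<open>The conjugate transpose and the semi-inner product of a positive-semidefinite matrix\<close>

lemma adjoint_carrier [simp]: "A \<in> carrier_mat n m \<Longrightarrow> mat_adjoint A \<in> carrier_mat m n"
  by (auto simp: mat_adjoint_def)

lemma adjoint_index [simp]:
  "i < dim_col A \<Longrightarrow> j < dim_row A \<Longrightarrow> mat_adjoint A $$ (i, j) = conjugate (A $$ (j, i))"
  by (simp add: mat_adjoint_def mat_of_rows_index)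

lemma adjoint_adjoint [simp]: "mat_adjoint (mat_adjoint A) = (A :: complex mat)"
  by (rule eq_matI) (auto simp: mat_adjoint_def mat_of_rows_index)

lemma adjoint_dim [simp]:
  "dim_row (mat_adjoint A) = dim_col A" "dim_col (mat_adjoint A) = dim_row A"
  by (auto simp: mat_adjoint_def)

lemma adjoint_mult:
  assumes "(A :: complex mat) \<in> carrier_mat n m" "B \<in> carrier_mat m k"
  shows "mat_adjoint (A * B) = mat_adjoint B * mat_adjoint A"
  using assms by (intro eq_matI) (auto simp: scalar_prod_def mult.commute)

lemma adjoint_diag: "mat_adjoint (mat_diag n d) = mat_diag n (\<lambda>i. cnj (d i))"
  by (rule eq_matI) (auto simp: mat_diag_def)

lemma cscalar_eq_sum:
  assumes "u \<in> carrier_vec n" "v \<in> carrier_vec n"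
  shows "u \<bullet>c v = (\<Sum>k = 0..<n. u $ k * cnj (v $ k))"
  using assms by (auto simp: scalar_prod_def)

lemma cscalar_swap:
  assumes "u \<in> carrier_vec n" "(v :: complex vec) \<in> carrier_vec n"
  shows "v \<bullet>c u = cnj (u \<bullet>c v)"
  using assms by (auto simp: cscalar_eq_sum[of _ n] mult.commute)

lemma adjoint_cscalar:
  assumes "(A :: complex mat) \<in> carrier_mat n m" "v \<in> carrier_vec m" "w \<in> carrier_vec n"
  shows "(A *\<^sub>v v) \<bullet>c w = v \<bullet>c (mat_adjoint A *\<^sub>v w)"
proof -
  have "(A *\<^sub>v v) \<bullet>c w = (\<Sum>i = 0..<n. \<Sum>j = 0..<m. A $$ (i, j) * v $ j * cnj (w $ i))"
    using assms by (simp add: cscalar_eq_sum[of _ n]) (auto simp: scalar_prod_def sum_distrib_right)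
  also have "\<dots> = (\<Sum>j = 0..<m. \<Sum>i = 0..<n. A $$ (i, j) * v $ j * cnj (w $ i))"
    by (rule sum.swap)
  also have "\<dots> = v \<bullet>c (mat_adjoint A *\<^sub>v w)"
    using assms mult_mat_vec_carrier[OF adjoint_carrier[OF assms(1)] assms(3)]
    by (subst cscalar_eq_sum[of _ m]) (auto simp: scalar_prod_def sum_distrib_left algebra_simps)
  finally show ?thesis .
qed

lemma psd_carrier: "psd_mat n T \<Longrightarrow> T \<in> carrier_mat n n"
  by (simp add: psd_mat_def)

lemma psd_adjoint: "psd_mat n T \<Longrightarrow> mat_adjoint T = T"
  by (simp add: psd_mat_def)

lemma psd_nonneg: "psd_mat n T \<Longrightarrow> v \<in> carrier_vec n \<Longrightarrow> 0 \<le> (T *\<^sub>v v) \<bullet>c v"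
  by (simp add: psd_mat_def)

lemma psd_swap:
  assumes "psd_mat n T" "u \<in> carrier_vec n" "v \<in> carrier_vec n"
  shows "(T *\<^sub>v v) \<bullet>c u = cnj ((T *\<^sub>v u) \<bullet>c v)"
  using assms
  by (metis adjoint_cscalar cscalar_swap mult_mat_vec_carrier psd_adjoint psd_carrier)

lemma psd_congruence:
  assumes T: "psd_mat n T" and X: "X \<in> carrier_mat n n"
  shows "psd_mat n (mat_adjoint X * T * X)"
proof -
  have c: "T \<in> carrier_mat n n" "mat_adjoint X \<in> carrier_mat n n"
    using psd_carrier[OF T] X by auto
  have "mat_adjoint (mat_adjoint X * T * X) = mat_adjoint X * T * X"
    using c X psd_adjoint[OF T]
    by (simp add: adjoint_mult[of _ n n _ n] assoc_mult_mat[of _ n n _ n _ n])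
  moreover have "0 \<le> ((mat_adjoint X * T * X) *\<^sub>v v) \<bullet>c v" if v: "v \<in> carrier_vec n" for v
  proof -
    have Xv: "X *\<^sub>v v \<in> carrier_vec n" using X v by simp
    have "((mat_adjoint X * T * X) *\<^sub>v v) \<bullet>c v = (mat_adjoint X *\<^sub>v (T *\<^sub>v (X *\<^sub>v v))) \<bullet>c v"
      using c X v by (simp add: assoc_mult_mat_vec[of _ n n _ n] mult_carrier_mat[of _ n n _ n])
    also have "\<dots> = (T *\<^sub>v (X *\<^sub>v v)) \<bullet>c (X *\<^sub>v v)"
      using c X v Xv by (subst adjoint_cscalar[of _ n n]) auto
    finally show ?thesis using psd_nonneg[OF T Xv] by simp
  qed
  moreover have "mat_adjoint X * T * X \<in> carrier_mat n n"
    using c X by (metis mult_carrier_mat)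
  ultimately show ?thesis unfolding psd_mat_def by blast
qed

lemma psd_expand:
  assumes T: "psd_mat n T" and x: "x \<in> carrier_vec n" and w: "w \<in> carrier_vec n"
  shows "(T *\<^sub>v (x + w)) \<bullet>c (x + w) =
    (T *\<^sub>v x) \<bullet>c x + (T *\<^sub>v w) \<bullet>c w + ((T *\<^sub>v x) \<bullet>c w + cnj ((T *\<^sub>v x) \<bullet>c w))"
proof -
  have c: "T \<in> carrier_mat n n" using psd_carrier[OF T] .
  have Tx: "T *\<^sub>v x \<in> carrier_vec n" "T *\<^sub>v w \<in> carrier_vec n" using c x w by auto
  have "(T *\<^sub>v (x + w)) \<bullet>c (x + w) = (T *\<^sub>v x + T *\<^sub>v w) \<bullet> (conjugate x + conjugate w)"
    using c x w by (simp add: mult_add_distrib_mat_vec[of _ n n] conjugate_add_vec[of _ n])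
  also have "\<dots> = (T *\<^sub>v x) \<bullet>c x + (T *\<^sub>v x) \<bullet>c w + ((T *\<^sub>v w) \<bullet>c x + (T *\<^sub>v w) \<bullet>c w)"
    using Tx x w by (simp add: add_scalar_prod_distrib[of _ n] scalar_prod_add_distrib[of _ n])
  finally show ?thesis using psd_swap[OF T x w] by simp
qed

text \<open>The quadratic polynomial \<open>t \<mapsto> \<langle>T (v - t T v), v - t T v\<rangle>\<close> is nonnegative, and for
  \<open>\<langle>T v, v\<rangle> = 0\<close> it has no constant term, so its linear coefficient \<open>-2 \<parallel>T v\<parallel>\<^sup>2\<close> has to
  vanish.\<close>

lemma psd_null_vector:
  assumes T: "psd_mat n T" and v: "v \<in> carrier_vec n" and z: "(T *\<^sub>v v) \<bullet>c v = 0"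
  shows "T *\<^sub>v v = 0\<^sub>v n"
proof (rule ccontr)
  assume nz: "T *\<^sub>v v \<noteq> 0\<^sub>v n"
  define y where "y = T *\<^sub>v v"
  have c: "T \<in> carrier_mat n n" using psd_carrier[OF T] .
  have y: "y \<in> carrier_vec n" using c v by (simp add: y_def)
  define a where "a = Re (y \<bullet>c y)"
  define b where "b = Re ((T *\<^sub>v y) \<bullet>c y)"
  have a: "a > 0"
    using nz y conjugate_square_greater_0_vec[OF y] by (simp add: a_def y_def less_complex_def)
  have b: "b \<ge> 0" using psd_nonneg[OF T y] by (simp add: b_def less_eq_complex_def)
  have key: "2 * s * a \<le> s\<^sup>2 * b" for s :: real
  proof -
    define w where "w = complex_of_real (- s) \<cdot>\<^sub>v y"
    have w: "w \<in> carrier_vec n" using y by (simp add: w_def)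
    have "conjugate w = complex_of_real (- s) \<cdot>\<^sub>v conjugate y"
      by (simp add: w_def conjugate_smult_vec)
    then have 1: "(T *\<^sub>v v) \<bullet>c w = complex_of_real (- s) * (y \<bullet>c y)"
      using y by (simp add: y_def[symmetric])
    have 2: "(T *\<^sub>v w) \<bullet>c w = complex_of_real (s\<^sup>2) * ((T *\<^sub>v y) \<bullet>c y)"
      using c y \<open>conjugate w = _\<close>
      by (simp add: w_def mult_mat_vec[of _ n n] power2_eq_square)
    have "0 \<le> Re ((T *\<^sub>v (v + w)) \<bullet>c (v + w))"
      using psd_nonneg[OF T, of "v + w"] v w by (simp add: less_eq_complex_def)
    then show ?thesis
      unfolding psd_expand[OF T v w] z 1 2 by (simp add: a_def b_def)
  qed
  \<comment> \<open>The optimal \<open>s\<close> is \<open>a / b\<close>; adding one in the denominator covers \<open>b = 0\<close>.\<close>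
  have "2 * (a / (b + 1)) * a \<le> (a / (b + 1))\<^sup>2 * b" by (rule key)
  also have "\<dots> \<le> (a / (b + 1))\<^sup>2 * (b + 1)" by (intro mult_left_mono) auto
  also have "\<dots> = a / (b + 1) * a"
    using b by (simp add: power2_eq_square nonzero_divide_eq_eq add_nonneg_eq_0_iff)
  finally have "a / (b + 1) * a \<le> 0" by simp
  moreover have "0 < a / (b + 1) * a" using a b by simp
  ultimately show False by simp
qed

section \<open>Orthogonal projection and distances to coordinate subspaces\<close>

lemma sum_supported:
  fixes f :: "nat \<Rightarrow> complex"
  assumes "K \<subseteq> {..<n}" "\<And>k. k < n \<Longrightarrow> k \<notin> K \<Longrightarrow> f k = 0"
  shows "(\<Sum>k = 0..<n. f k) = (\<Sum>k\<in>K. f k)"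
  using assms by (intro sum.mono_neutral_right) auto

lemma cscalar_supported:
  assumes "u \<in> carrier_vec n" "(w :: complex vec) \<in> carrier_vec n"
    and "\<And>j. j < n \<Longrightarrow> u $ j = 0 \<or> w $ j = 0"
  shows "u \<bullet>c w = 0"
  using assms by (subst cscalar_eq_sum[of _ n]) (auto intro!: sum.neutral)

text \<open>Gram--Schmidt in the seminorm of \<open>T\<close>, one coordinate direction at a time: the new direction
  is first made orthogonal to the old ones. If its seminorm is zero, it is annihilated by
  \<open>T\<close>, so orthogonality to it is automatic and no correction is called for.\<close>

lemma psd_projection:
  assumes T: "psd_mat n T" and K: "K \<subseteq> {..<n}" and u: "u \<in> carrier_vec n"
  shows "\<exists>w \<in> carrier_vec n. (\<forall>j<n. j \<notin> K \<longrightarrow> w $ j = 0) \<and> (\<forall>j\<in>K. (T *\<^sub>v (u + w)) $ j = 0)"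
proof -
  have c: "T \<in> carrier_mat n n" using psd_carrier[OF T] .
  have "finite K" using K finite_subset by blast
  then show ?thesis using K u
  proof (induction K arbitrary: u rule: finite_induct)
    case empty
    then show ?case by (intro bexI[of _ "0\<^sub>v n"]) auto
  next
    case (insert k K)
    then have k: "k < n" and K: "K \<subseteq> {..<n}" by auto
    from insert.IH[OF K insert.prems(2)] obtain w where w: "w \<in> carrier_vec n"
      "\<And>j. j < n \<Longrightarrow> j \<notin> K \<Longrightarrow> w $ j = 0" "\<And>j. j \<in> K \<Longrightarrow> (T *\<^sub>v (u + w)) $ j = 0" by blast
    from insert.IH[OF K, of "unit_vec n k"] obtain g where g: "g \<in> carrier_vec n"
      "\<And>j. j < n \<Longrightarrow> j \<notin> K \<Longrightarrow> g $ j = 0" "\<And>j. j \<in> K \<Longrightarrow> (T *\<^sub>v (unit_vec n k + g)) $ j = 0"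
      by auto
    \<comment> \<open>\<open>x\<close> and \<open>f\<close> are \<open>u\<close> and \<open>e\<^sub>k\<close> with their components along \<open>K\<close> removed.\<close>
    define f where "f = unit_vec n k + g"
    define x where "x = u + w"
    have f: "f \<in> carrier_vec n" and x: "x \<in> carrier_vec n"
      using g w insert.prems by (auto simp: f_def x_def)
    have Tf: "T *\<^sub>v f \<in> carrier_vec n" and Tx: "T *\<^sub>v x \<in> carrier_vec n" using c f x by auto
    have f_k: "y \<bullet>c f = y $ k" if y: "y \<in> carrier_vec n" and "\<And>j. j \<in> K \<Longrightarrow> y $ j = 0" for y
    proof -
      have "y \<bullet>c f = (\<Sum>j = 0..<n. if j = k then y $ j else 0)"
      proof (subst cscalar_eq_sum[OF y f], intro sum.cong refl)
        fix j assume "j \<in> {0..<n}"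
        then have j: "j < n" by simp
        have fj: "f $ j = (if j = k then 1 else 0) + g $ j" using j k g(1) by (simp add: f_def)
        show "y $ j * cnj (f $ j) = (if j = k then y $ j else 0)"
        proof (cases "j \<in> K")
          case True
          then show ?thesis using that(2) insert.hyps by auto
        next
          case False
          then show ?thesis using g(2)[OF j] fj by simp
        qed
      qed
      then show ?thesis using k by simp
    qed
    have in_K: "(T *\<^sub>v x) $ j = 0" "(T *\<^sub>v f) $ j = 0" if "j \<in> K" for j
      using that w g by (auto simp: x_def f_def simp del: index_mult_mat_vec)
    define t where "t = (if (T *\<^sub>v f) \<bullet>c f = 0 then 0 else - ((T *\<^sub>v x) $ k / (T *\<^sub>v f) $ k))"
    have at_k: "(T *\<^sub>v x) $ k + t * (T *\<^sub>v f) $ k = 0"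
    proof (cases "(T *\<^sub>v f) \<bullet>c f = 0")
      case True
      have "(T *\<^sub>v x) \<bullet>c f = cnj ((T *\<^sub>v f) \<bullet>c x)" using psd_swap[OF T f x] .
      also have "\<dots> = 0" using psd_null_vector[OF T f True] x by simp
      finally have "(T *\<^sub>v x) $ k = 0" using f_k[OF Tx] in_K by (simp del: index_mult_mat_vec)
      then show ?thesis using True by (simp add: t_def del: index_mult_mat_vec)
    next
      case False
      then have "(T *\<^sub>v f) $ k \<noteq> 0" using f_k[OF Tf] in_K by (simp del: index_mult_mat_vec)
      then show ?thesis using False by (simp add: t_def del: index_mult_mat_vec)
    qed
    have eq: "T *\<^sub>v (u + (w + t \<cdot>\<^sub>v f)) = T *\<^sub>v x + t \<cdot>\<^sub>v (T *\<^sub>v f)"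
    proof -
      have "u + (w + t \<cdot>\<^sub>v f) = x + t \<cdot>\<^sub>v f"
        using f w insert.prems by (intro eq_vecI) (auto simp: x_def)
      then show ?thesis
        using c f x by (simp add: mult_add_distrib_mat_vec[of _ n n] mult_mat_vec[of _ n n])
    qed
    have "(T *\<^sub>v (u + (w + t \<cdot>\<^sub>v f))) $ j = 0" if "j \<in> insert k K" for j
    proof -
      have j: "j < n" using that k K by auto
      have "(T *\<^sub>v (u + (w + t \<cdot>\<^sub>v f))) $ j = (T *\<^sub>v x) $ j + t * (T *\<^sub>v f) $ j"
        unfolding eq using j carrier_vecD[OF Tf] carrier_vecD[OF Tx]
        by (simp del: index_mult_mat_vec dim_mult_mat_vec)
      also have "\<dots> = 0" using that at_k in_K by (auto simp del: index_mult_mat_vec)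
      finally show ?thesis .
    qed
    moreover have "(w + t \<cdot>\<^sub>v f) $ j = 0" if "j < n" "j \<notin> insert k K" for j
      using that w g f k by (auto simp: f_def)
    ultimately show ?case using w f by (intro bexI[of _ "w + t \<cdot>\<^sub>v f"]) auto
  qed
qed

text \<open>Pythagoras in the seminorm of \<open>T\<close>.\<close>

lemma psd_pythagoras:
  assumes T: "psd_mat n T" and x: "x \<in> carrier_vec n" and w: "w \<in> carrier_vec n"
    and K: "\<And>j. j < n \<Longrightarrow> j \<notin> K \<Longrightarrow> w $ j = 0" "\<And>j. j \<in> K \<Longrightarrow> (T *\<^sub>v x) $ j = 0"
  shows "(T *\<^sub>v (x + w)) \<bullet>c (x + w) = (T *\<^sub>v x) \<bullet>c x + (T *\<^sub>v w) \<bullet>c w"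
proof -
  have "(T *\<^sub>v x) \<bullet>c w = 0"
    using psd_carrier[OF T] x w K
    by (intro cscalar_supported[of _ n]) (auto simp del: index_mult_mat_vec)
  then show ?thesis using psd_expand[OF T x w] by simp
qed

lemma cspan_unit_vecs:
  assumes K: "K \<subseteq> {..<n}"
  shows "cspan n (unit_vec n ` K) = {v \<in> carrier_vec n. \<forall>j<n. j \<notin> K \<longrightarrow> v $ j = 0}"
proof -
  interpret vs: vec_space "TYPE(complex)" n .
  have fin: "finite K" using K finite_subset by blast
  have U: "unit_vec n ` K \<subseteq> carrier_vec n" by auto
  have cs: "cspan n X = vs.span X" for X by (simp add: cspan_def)
  have sub: "v \<in> vs.span (unit_vec n ` K)"
    if "v \<in> carrier_vec n" "\<forall>j<n. j \<notin> K \<longrightarrow> v $ j = 0" for v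
    using fin K that
  proof (induction K arbitrary: v rule: finite_induct)
    case empty
    then have "v = 0\<^sub>v n" by (intro eq_vecI) auto
    then show ?case using vs.span_empty by simp
  next
    case (insert k K)
    define v' where "v' = v - v $ k \<cdot>\<^sub>v unit_vec n k"
    have k: "k < n" using insert by auto
    have "v' \<in> vs.span (unit_vec n ` K)"
      using insert.prems k insert.hyps by (intro insert.IH) (auto simp: v'_def)
    then have "v' \<in> vs.span (unit_vec n ` insert k K)"
      using vs.span_is_monotone[of "unit_vec n ` K" "unit_vec n ` insert k K"] by auto
    moreover have "v $ k \<cdot>\<^sub>v unit_vec n k \<in> vs.span (unit_vec n ` insert k K)"
      by (intro vs.smult_in_span) (auto intro!: vs.span_mem)
    moreover have "v = v' + v $ k \<cdot>\<^sub>v unit_vec n k"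
      using insert.prems k by (intro eq_vecI) (auto simp: v'_def)
    ultimately show ?case
      by (metis (no_types, lifting) vs.span_add1 image_subsetI unit_vec_carrier)
  qed
  have sup: "v \<in> carrier_vec n \<and> (\<forall>j<n. j \<notin> K \<longrightarrow> v $ j = 0)"
    if v: "v \<in> vs.span (unit_vec n ` K)" for v
  proof -
    obtain a where a: "v = vs.lincomb a (unit_vec n ` K)"
      using v fin U vs.finite_span[of "unit_vec n ` K"] by auto
    have "v $ j = 0" if j: "j < n" "j \<notin> K" for j
    proof -
      have "v $ j = (\<Sum>x\<in>unit_vec n ` K. a x * x $ j)"
        unfolding a using j U by (intro vs.lincomb_index) auto
      also have "\<dots> = 0" proof (intro sum.neutral ballI)
        fix x :: "complex vec" assume "x \<in> unit_vec n ` K"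
        then obtain k where k: "k \<in> K" and x: "x = unit_vec n k" by blast
        then have "k < n" "k \<noteq> j" using K j by auto
        then show "a x * x $ j = 0" using j unfolding x by simp
      qed
      finally show ?thesis .
    qed
    then show ?thesis using v U vs.span_closed by blast
  qed
  show ?thesis unfolding cs using sub sup by blast
qed

lemma mat_dist_sq:
  assumes "psd_mat n T" "u \<in> carrier_vec n" "v \<in> carrier_vec n"
  shows "(mat_dist T u v)\<^sup>2 = Re ((T *\<^sub>v (u - v)) \<bullet>c (u - v))"
  using psd_nonneg[OF assms(1), of "u - v"] assms
  by (simp add: mat_dist_def less_eq_complex_def)

lemma mat_setdist_bounds:
  assumes T: "psd_mat n T" and v: "v \<in> V" and V: "V \<subseteq> carrier_vec n" and u: "u \<in> carrier_vec n"
  shows "0 \<le> mat_setdist T u V" "mat_setdist T u V \<le> mat_dist T u v"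
proof -
  have nn: "0 \<le> mat_dist T u x" if "x \<in> V" for x
    using that psd_nonneg[OF T, of "u - x"] u V
    by (auto simp: mat_dist_def less_eq_complex_def subset_eq)
  then show "0 \<le> mat_setdist T u V" unfolding mat_setdist_def using v by (intro cINF_greatest) auto
  show "mat_setdist T u V \<le> mat_dist T u v"
    unfolding mat_setdist_def using v nn by (intro cINF_lower) (auto intro!: bdd_belowI2)
qed

lemma setdist_sq_le:
  assumes T: "psd_mat n T" and K: "K \<subseteq> {..<n}" and u: "u \<in> carrier_vec n"
    and x: "x \<in> carrier_vec n" "\<And>j. j < n \<Longrightarrow> j \<notin> K \<Longrightarrow> x $ j = u $ j"
  shows "(mat_setdist T u (cspan n (unit_vec n ` K)))\<^sup>2 \<le> Re ((T *\<^sub>v x) \<bullet>c x)"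
proof -
  define V where "V = cspan n (unit_vec n ` K)"
  have V: "V = {v \<in> carrier_vec n. \<forall>j<n. j \<notin> K \<longrightarrow> v $ j = 0}"
    unfolding V_def by (rule cspan_unit_vecs[OF K])
  have mem: "u - x \<in> V" using u x by (auto simp: V)
  have Vc: "V \<subseteq> carrier_vec n" by (auto simp: V)
  have *: "u - (u - x) = x" using u x by (intro eq_vecI) auto
  have "(mat_setdist T u V)\<^sup>2 \<le> (mat_dist T u (u - x))\<^sup>2"
    using mat_setdist_bounds[OF T mem Vc u] by (intro power_mono) auto
  also have "\<dots> = Re ((T *\<^sub>v x) \<bullet>c x)" using mat_dist_sq[OF T u, of "u - x"] u x by (simp add: *)
  finally show ?thesis by (simp add: V_def)
qed

lemma setdist_sq_eq:
  assumes T: "psd_mat n T" and K: "K \<subseteq> {..<n}" and u: "u \<in> carrier_vec n"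
    and x: "x \<in> carrier_vec n" "\<And>j. j < n \<Longrightarrow> j \<notin> K \<Longrightarrow> x $ j = u $ j"
    and orth: "\<And>j. j \<in> K \<Longrightarrow> (T *\<^sub>v x) $ j = 0"
  shows "(mat_setdist T u (cspan n (unit_vec n ` K)))\<^sup>2 = Re ((T *\<^sub>v x) \<bullet>c x)"
proof (rule antisym)
  define V where "V = cspan n (unit_vec n ` K)"
  have V: "V = {v \<in> carrier_vec n. \<forall>j<n. j \<notin> K \<longrightarrow> v $ j = 0}"
    unfolding V_def by (rule cspan_unit_vecs[OF K])
  have "sqrt (Re ((T *\<^sub>v x) \<bullet>c x)) \<le> mat_setdist T u V"
    unfolding mat_setdist_def
  proof (rule cINF_greatest)
    show "V \<noteq> {}" using V by (auto intro!: exI[of _ "0\<^sub>v n"])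
    fix v assume v: "v \<in> V"
    define w where "w = u - v - x"
    have w: "w \<in> carrier_vec n" "\<And>j. j < n \<Longrightarrow> j \<notin> K \<Longrightarrow> w $ j = 0"
      using u v x by (auto simp: V w_def)
    have "u - v = x + w" using u v x by (intro eq_vecI) (auto simp: V w_def)
    then have "(T *\<^sub>v (u - v)) \<bullet>c (u - v) = (T *\<^sub>v x) \<bullet>c x + (T *\<^sub>v w) \<bullet>c w"
      using psd_pythagoras[OF T x(1) w(1,2) orth] by simp
    then show "sqrt (Re ((T *\<^sub>v x) \<bullet>c x)) \<le> mat_dist T u v"
      using psd_nonneg[OF T w(1)] by (simp add: mat_dist_def less_eq_complex_def)
  qed
  moreover have "0 \<le> Re ((T *\<^sub>v x) \<bullet>c x)"
    using psd_nonneg[OF T x(1)] by (simp add: less_eq_complex_def)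
  ultimately show "Re ((T *\<^sub>v x) \<bullet>c x) \<le> (mat_setdist T u (cspan n (unit_vec n ` K)))\<^sup>2"
    unfolding V_def by (metis power_mono real_sqrt_ge_zero real_sqrt_pow2)
qed (rule setdist_sq_le[OF T K u x])

section \<open>Ranges, pseudoinverses and similarity invariants\<close>

lemma range_subset_iff:
  assumes A: "(A :: complex mat) \<in> carrier_mat n n" and B: "B \<in> carrier_mat n n"
  shows "mat_range A \<subseteq> mat_range B \<longleftrightarrow> (\<exists>X \<in> carrier_mat n n. A = B * X)"
proof
  assume sub: "mat_range A \<subseteq> mat_range B"
  have "\<exists>x \<in> carrier_vec n. col A j = B *\<^sub>v x" if j: "j < n" for j
  proof -
    have "A *\<^sub>v unit_vec n j = col A j"
      using A j by (intro eq_vecI) auto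
    then have "col A j \<in> mat_range A"
      using A by (auto simp: mat_range_def intro!: image_eqI[of _ _ "unit_vec n j"])
    then show ?thesis using sub B by (auto simp: mat_range_def)
  qed
  then obtain f where f: "\<And>j. j < n \<Longrightarrow> f j \<in> carrier_vec n \<and> col A j = B *\<^sub>v f j" by metis
  define X where "X = mat_of_cols n (map f [0..<n])"
  have X: "X \<in> carrier_mat n n" by (simp add: X_def mat_of_cols_def)
  have "col X j = f j" if "j < n" for j
    unfolding X_def using that f by (subst col_mat_of_cols) auto
  then have "A = B * X"
    using f A B X by (intro mat_col_eqI) auto
  then show "\<exists>X \<in> carrier_mat n n. A = B * X" using X by blast
next
  assume "\<exists>X \<in> carrier_mat n n. A = B * X"
  then obtain X where X: "X \<in> carrier_mat n n" "A = B * X" by blast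
  show "mat_range A \<subseteq> mat_range B"
  proof
    fix y assume "y \<in> mat_range A"
    then obtain v where v: "v \<in> carrier_vec n" "y = A *\<^sub>v v" using A by (auto simp: mat_range_def)
    then have "y = B *\<^sub>v (X *\<^sub>v v)" using B X by (simp add: assoc_mult_mat_vec[of _ n n])
    then show "y \<in> mat_range B" using B X v by (auto simp: mat_range_def)
  qed
qed

lemma adjoint_add:
  assumes "(A :: complex mat) \<in> carrier_mat n m" "B \<in> carrier_mat n m"
  shows "mat_adjoint (A + B) = mat_adjoint A + mat_adjoint B"
  using assms by (intro eq_matI) auto

text \<open>The classical argument: \<open>M X\<close> and \<open>M Y\<close> are Hermitian idempotents that absorb each other,
  hence equal, and likewise \<open>X M = Y M\<close>.\<close>

lemma is_pinv_unique:
  assumes M: "M \<in> carrier_mat n n" and X: "is_pinv M X" and Y: "is_pinv M Y"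
  shows "X = Y"
proof -
  have c: "X \<in> carrier_mat n n" "Y \<in> carrier_mat n n"
    using M X Y by (auto simp: is_pinv_def)
  note as = assoc_mult_mat[of _ n n _ n _ n] mult_carrier_mat[of _ n n _ n]
  note x = X[unfolded is_pinv_def] and y = Y[unfolded is_pinv_def]
  have "M * X = (M * Y * M) * X" using y by simp
  also have "\<dots> = (M * Y) * (M * X)" using M c by (simp add: as)
  also have "\<dots> = mat_adjoint (M * Y) * mat_adjoint (M * X)" using x y by simp
  also have "\<dots> = mat_adjoint ((M * X) * (M * Y))"
    using M c by (subst adjoint_mult[of _ n n _ n]) (auto simp: as)
  also have "(M * X) * (M * Y) = (M * X * M) * Y" using M c by (simp add: as)
  also have "\<dots> = M * Y" using x by simp
  also have "mat_adjoint \<dots> = M * Y" using y by simp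
  finally have MX: "M * X = M * Y" .
  have "X * M = X * (M * Y * M)" using y by simp
  also have "\<dots> = (X * M) * (Y * M)" using M c by (simp add: as)
  also have "\<dots> = mat_adjoint (X * M) * mat_adjoint (Y * M)" using x y by simp
  also have "\<dots> = mat_adjoint ((Y * M) * (X * M))"
    using M c by (subst adjoint_mult[of _ n n _ n]) (auto simp: as)
  also have "(Y * M) * (X * M) = Y * (M * X * M)" using M c by (simp add: as)
  also have "\<dots> = Y * M" using x by simp
  also have "mat_adjoint \<dots> = Y * M" using y by simp
  finally have XM: "X * M = Y * M" .
  have "X = X * M * X" using x by simp
  also have "\<dots> = Y * (M * X)" unfolding XM using M c by (simp add: as)
  also have "\<dots> = Y * M * Y" unfolding MX using M c by (simp add: as)
  also have "\<dots> = Y" using y by simp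
  finally show ?thesis .
qed

lemma pinv_eqI:
  assumes "M \<in> carrier_mat n n" "is_pinv M X"
  shows "pinv M = X"
  unfolding pinv_def using assms is_pinv_unique by blast

lemma diag_index [simp]:
  "i < n \<Longrightarrow> j < n \<Longrightarrow> mat_diag n d $$ (i, j) = (if i = j then d i else 0)"
  by (auto simp: mat_diag_def)

lemma dim_diag [simp]: "dim_row (mat_diag n d) = n" "dim_col (mat_diag n d) = n"
  by (auto simp: mat_diag_def)

lemma diag_cong:
  assumes "\<And>i. i < n \<Longrightarrow> c i = d i"
  shows "mat_diag n c = mat_diag n d"
  using assms by (intro eq_matI) auto

lemma diag_zero: "0\<^sub>m n n = mat_diag n (\<lambda>i. 0)"
  by (intro eq_matI) auto

lemma det_diag: "det (mat_diag n d) = (\<Prod>i<n. (d i :: complex))"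
  by (subst det_lower_triangular[of n])
    (auto simp: prod_list_diag_prod mat_diag_def lessThan_atLeast0)

lemma inverse_of_det_nonzero:
  assumes "(N :: complex mat) \<in> carrier_mat n n" "det N \<noteq> 0"
  shows "\<exists>X \<in> carrier_mat n n. X * N = 1\<^sub>m n \<and> N * X = 1\<^sub>m n"
  using det_non_zero_imp_unit[OF assms, of "()"] by (auto simp: Units_def ring_mat_def)

abbreviation supp_proj :: "nat \<Rightarrow> (nat \<Rightarrow> complex) \<Rightarrow> complex mat" where
  "supp_proj n d \<equiv> mat_diag n (\<lambda>i. if d i = 0 then 0 else 1)"

abbreviation ker_proj :: "nat \<Rightarrow> (nat \<Rightarrow> complex) \<Rightarrow> complex mat" where
  "ker_proj n d \<equiv> mat_diag n (\<lambda>i. if d i = 0 then 1 else 0)"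

lemma supp_plus_ker: "supp_proj n d + ker_proj n d = 1\<^sub>m n"
  by (rule eq_matI) (auto simp: mat_diag_def)

text \<open>The explicit pseudoinverse of a congruence transform of a diagonal matrix. With \<open>E\<close> and \<open>J\<close>
  the projections onto the support of \<open>\<Delta>\<close> and onto its kernel, the Gram matrix \<open>E K\<^sup>* K E\<close> is
  singular exactly along \<open>J\<close>, so \<open>N = E K\<^sup>* K E + J\<close> is invertible, and
  \<open>K E N\<^sup>-\<^sup>1 \<Delta>\<^sup>+ N\<^sup>-\<^sup>1 E K\<^sup>*\<close> satisfies the Penrose equations.\<close>

lemma is_pinv_congruence:
  fixes d :: "nat \<Rightarrow> complex"
  assumes K: "K \<in> carrier_mat n n" and detK: "det K \<noteq> 0"
  shows "\<exists>X. is_pinv (K * mat_diag n d * mat_adjoint K) X"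
proof -
  define Ks where "Ks = mat_adjoint K"
  define E where "E = supp_proj n d"
  define J where "J = ker_proj n d"
  define \<Delta> where "\<Delta> = mat_diag n d"
  define \<Delta>i where "\<Delta>i = mat_diag n (\<lambda>i. inverse (d i))"
  define G where "G = E * Ks * K * E"
  define N where "N = G + J"
  have c: "Ks \<in> carrier_mat n n" "E \<in> carrier_mat n n" "J \<in> carrier_mat n n"
    "\<Delta> \<in> carrier_mat n n" "\<Delta>i \<in> carrier_mat n n"
    using K by (auto simp: Ks_def E_def J_def \<Delta>_def \<Delta>i_def)
  have G: "G \<in> carrier_mat n n" using c K by (metis G_def mult_carrier_mat)
  have N: "N \<in> carrier_mat n n" using c G by (simp add: N_def)
  note as = assoc_mult_mat[of _ n n _ n _ n] mult_carrier_mat[of _ n n _ n]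
  have diag: "E * E = E" "E * J = 0\<^sub>m n n" "J * E = 0\<^sub>m n n" "\<Delta> * E = \<Delta>" "E * \<Delta> = \<Delta>"
    "\<Delta>i * E = \<Delta>i" "E * \<Delta>i = \<Delta>i" "\<Delta> * \<Delta>i = E" "\<Delta>i * \<Delta> = E"
    by (auto simp: E_def J_def \<Delta>_def \<Delta>i_def diag_zero intro!: diag_cong)
  have adj: "mat_adjoint E = E" "mat_adjoint J = J" "mat_adjoint Ks = K" "mat_adjoint K = Ks"
    by (auto simp: E_def J_def Ks_def adjoint_diag if_distrib cong: if_cong)
  have EJ: "E + J = 1\<^sub>m n" unfolding E_def J_def by (rule supp_plus_ker)
  have cancel: "E * (E * Z) = E * Z" "\<Delta> * (E * Z) = \<Delta> * Z" "E * (\<Delta> * Z) = \<Delta> * Z"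
    "\<Delta>i * (E * Z) = \<Delta>i * Z" "\<Delta> * (\<Delta>i * Z) = E * Z" "\<Delta>i * (\<Delta> * Z) = E * Z"
    if "Z \<in> carrier_mat n n" for Z
    using that by (simp_all only: assoc_mult_mat[of _ n n _ n _ n, symmetric] diag c)
  have EG: "E * G = G" "G * E = G"
    using c K G diag(1) unfolding G_def by (simp_all add: as cancel(1))
  have EN: "E * N = G" "N * E = G"
    using c G
    by (simp_all add: N_def mult_add_distrib_mat[of _ n n _ n] add_mult_distrib_mat[of _ n n _ _ n]
        EG diag)
  have "mat_adjoint G = G"
    unfolding G_def using c K by (simp add: adjoint_mult[of _ n n _ n] adj as)
  then have Nh: "mat_adjoint N = N"
    unfolding N_def using c G adj(2) by (simp add: adjoint_add[of _ n n])
  have "det N \<noteq> 0"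
  proof
    assume "det N = 0"
    then obtain v where v: "v \<in> carrier_vec n" "v \<noteq> 0\<^sub>v n" "N *\<^sub>v v = 0\<^sub>v n"
      using det_0_iff_vec_prod_zero_field[OF N] by blast
    have Ev: "E *\<^sub>v v \<in> carrier_vec n" "J *\<^sub>v v \<in> carrier_vec n" using c v by auto
    have KE: "K *\<^sub>v (E *\<^sub>v v) \<in> carrier_vec n" using K Ev by auto
    have "J * J = J" by (auto simp: J_def intro!: diag_cong)
    then have JJ: "J *\<^sub>v v = J *\<^sub>v (J *\<^sub>v v)"
      using assoc_mult_mat_vec[OF c(3) c(3) v(1)] by simp
    have "G *\<^sub>v v = E *\<^sub>v (Ks *\<^sub>v (K *\<^sub>v (E *\<^sub>v v)))"
      using c K v by (simp add: G_def as assoc_mult_mat_vec[of _ n n _ n])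
    then have "(G *\<^sub>v v) \<bullet>c v = (Ks *\<^sub>v (K *\<^sub>v (E *\<^sub>v v))) \<bullet>c (E *\<^sub>v v)"
      using adjoint_cscalar[OF c(2) mult_mat_vec_carrier[OF c(1) KE] v(1)] by (simp add: adj)
    also have "\<dots> = (K *\<^sub>v (E *\<^sub>v v)) \<bullet>c (K *\<^sub>v (E *\<^sub>v v))"
      using c KE Ev by (subst adjoint_cscalar[of _ n n]) (auto simp: adj)
    finally have 1: "(G *\<^sub>v v) \<bullet>c v = (K *\<^sub>v (E *\<^sub>v v)) \<bullet>c (K *\<^sub>v (E *\<^sub>v v))" .
    have 2: "(J *\<^sub>v v) \<bullet>c v = (J *\<^sub>v v) \<bullet>c (J *\<^sub>v v)"
      using c Ev v by (subst JJ, subst adjoint_cscalar[of _ n n]) (auto simp: adj)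
    have "0 = (N *\<^sub>v v) \<bullet>c v" using v by simp
    also have "\<dots> = (G *\<^sub>v v) \<bullet>c v + (J *\<^sub>v v) \<bullet>c v"
      using c G v(1)
      by (simp add: N_def add_mult_distrib_mat_vec[of _ n n] add_scalar_prod_distrib[of _ n])
    finally have "(K *\<^sub>v (E *\<^sub>v v)) \<bullet>c (K *\<^sub>v (E *\<^sub>v v)) + (J *\<^sub>v v) \<bullet>c (J *\<^sub>v v) = 0"
      using 1 2 by simp
    then have "(K *\<^sub>v (E *\<^sub>v v)) \<bullet>c (K *\<^sub>v (E *\<^sub>v v)) = 0 \<and> (J *\<^sub>v v) \<bullet>c (J *\<^sub>v v) = 0"
      by (subst (asm) add_nonneg_eq_0_iff) auto
    then have z: "K *\<^sub>v (E *\<^sub>v v) = 0\<^sub>v n" "J *\<^sub>v v = 0\<^sub>v n" using KE Ev by auto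
    then have "E *\<^sub>v v = 0\<^sub>v n"
      using det_0_iff_vec_prod_zero_field[OF K] detK Ev by blast
    then have "(E + J) *\<^sub>v v = 0\<^sub>v n"
      using c v z by (simp add: add_mult_distrib_mat_vec[of _ n n])
    then show False using EJ v by simp
  qed
  then obtain Ni where Ni: "Ni \<in> carrier_mat n n" "Ni * N = 1\<^sub>m n" "N * Ni = 1\<^sub>m n"
    using inverse_of_det_nonzero[OF N] by blast
  have NNi: "N * (Ni * Z) = Z" "Ni * (N * Z) = Z" if "Z \<in> carrier_mat n n" for Z
    using that
    by (simp_all only: assoc_mult_mat[of _ n n _ n _ n, symmetric] N Ni left_mult_one_mat[of _ n n])
  have ENi: "E * Ni = Ni * E"
  proof -
    have "E * Ni = Ni * (N * (E * Ni))" using c Ni(1) by (simp add: NNi as)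
    also have "\<dots> = Ni * (N * E) * Ni" using c N Ni by (simp add: as)
    also have "N * E = E * N" using EN by simp
    also have "Ni * (E * N) * Ni = Ni * E * (N * Ni)" using c N Ni by (simp add: as)
    finally show ?thesis using c Ni by (simp add: as)
  qed
  have Nih: "mat_adjoint Ni = Ni"
  proof -
    have "mat_adjoint (N * Ni) = mat_adjoint Ni * N"
      using adjoint_mult[OF N Ni(1)] by (simp add: Nh)
    moreover have "mat_adjoint (1\<^sub>m n :: complex mat) = 1\<^sub>m n" by (intro eq_matI) auto
    ultimately have "mat_adjoint Ni * N = 1\<^sub>m n" using Ni by simp
    then have "mat_adjoint Ni * N * Ni = Ni" using Ni(1) by simp
    moreover have "mat_adjoint Ni * N * Ni = mat_adjoint Ni * (N * Ni)"
      using N Ni(1) by (intro as) auto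
    ultimately show ?thesis using Ni by simp
  qed
  define B where "B = K * \<Delta> * Ks"
  define X where "X = K * E * Ni * \<Delta>i * Ni * E * Ks"
  define Q where "Q = K * E * Ni * Ks"
  have BXQ: "B \<in> carrier_mat n n" "X \<in> carrier_mat n n" "Q \<in> carrier_mat n n"
    using c K Ni unfolding B_def X_def Q_def by (simp_all add: as)
  have swap: "E * (Ni * Z) = Ni * (E * Z)" if "Z \<in> carrier_mat n n" for Z
    using that by (simp only: assoc_mult_mat[of _ n n _ n _ n, symmetric] c Ni(1) ENi)
  have EKKE: "E * (Ks * (K * (E * Z))) = G * Z" if "Z \<in> carrier_mat n n" for Z
    using c K that by (simp add: G_def as)
  have GNi: "G * (Ni * Z) = E * Z" if "Z \<in> carrier_mat n n" for Z
  proof -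
    have "G * (Ni * Z) = E * (N * (Ni * Z))"
      using c N Ni that by (simp add: EN(1)[symmetric] as)
    then show ?thesis using NNi that by simp
  qed
  have NiG: "Ni * (G * Z) = E * Z" if "Z \<in> carrier_mat n n" for Z
  proof -
    have "Ni * (G * Z) = Ni * (N * (E * Z))"
      using c N Ni that by (simp add: EN(2)[symmetric] as)
    then show ?thesis using NNi that c by (simp add: as)
  qed
  note car = c K Ni(1) mult_carrier_mat[of _ n n _ n]
  have Q': "Q = K * (Ni * (E * Ks))"
    unfolding Q_def using c K Ni by (simp add: swap as)
  have BX: "B * X = Q"
  proof -
    have "B * X = K * (\<Delta> * (Ks * (K * (E * (Ni * (\<Delta>i * (Ni * (E * Ks))))))))"
      unfolding B_def X_def by (simp only: as car)
    also have "\<dots> = K * (\<Delta> * (E * (Ks * (K * (E * (Ni * (\<Delta>i * (Ni * (E * Ks)))))))))"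
      by (simp only: cancel car)
    also have "\<dots> = K * (\<Delta> * (E * (\<Delta>i * (Ni * (E * Ks)))))"
      by (simp only: EKKE GNi car)
    also have "\<dots> = K * (E * (Ni * (E * Ks)))"
      by (simp only: cancel car)
    also have "\<dots> = Q"
      by (simp only: Q' swap cancel car)
    finally show ?thesis .
  qed
  have XB: "X * B = Q"
  proof -
    have "X * B = K * (E * (Ni * (\<Delta>i * (Ni * (E * (Ks * (K * (\<Delta> * Ks))))))))"
      unfolding B_def X_def by (simp only: as car)
    also have "\<dots> = K * (E * (Ni * (\<Delta>i * (Ni * (E * (Ks * (K * (E * (\<Delta> * Ks)))))))))"
      by (simp only: cancel car)
    also have "\<dots> = K * (E * (Ni * (\<Delta>i * (E * (\<Delta> * Ks)))))"
      by (simp only: EKKE NiG car)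
    also have "\<dots> = Q"
      by (simp only: Q' swap cancel car)
    finally show ?thesis .
  qed
  have Qh: "mat_adjoint Q = Q"
  proof -
    have "mat_adjoint Q = K * (Ni * (E * Ks))"
      unfolding Q_def by (simp only: adjoint_mult[of _ n n _ n] adj Nih as car)
    then show ?thesis unfolding Q' .
  qed
  have QKE: "Q * (K * (E * Z)) = K * (E * Z)" if Z: "Z \<in> carrier_mat n n" for Z
  proof -
    have "Q * (K * (E * Z)) = K * (Ni * (E * (Ks * (K * (E * Z)))))"
      unfolding Q' by (simp only: as car Z)
    then show ?thesis by (simp only: EKKE NiG car Z)
  qed
  have QB: "Q * B = B"
  proof -
    have "B = K * (E * (\<Delta> * Ks))" unfolding B_def by (simp only: as cancel car)
    then show ?thesis using QKE[of "\<Delta> * Ks"] c by (simp only: car)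
  qed
  have QX: "Q * X = X"
  proof -
    have "X = K * (E * (Ni * (\<Delta>i * (Ni * (E * Ks)))))" unfolding X_def by (simp only: as car)
    then show ?thesis using QKE[of "Ni * (\<Delta>i * (Ni * (E * Ks)))"] by (simp only: car)
  qed
  have "is_pinv B X"
    unfolding is_pinv_def BX XB using BXQ Qh QB QX by auto
  then show ?thesis unfolding B_def \<Delta>_def Ks_def by blast
qed

lemma trace_mult_comm:
  assumes "A \<in> carrier_mat n n" "B \<in> carrier_mat n n"
  shows "mat_trace (A * B) = mat_trace (B * A)"
proof -
  have "mat_trace (A * B) = (\<Sum>i = 0..<n. \<Sum>k = 0..<n. A $$ (i, k) * B $$ (k, i))"
    using assms by (simp add: mat_trace_def scalar_prod_def)
  also have "\<dots> = (\<Sum>k = 0..<n. \<Sum>i = 0..<n. A $$ (i, k) * B $$ (k, i))"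
    by (rule sum.swap)
  also have "\<dots> = mat_trace (B * A)"
    using assms by (simp add: mat_trace_def scalar_prod_def mult.commute)
  finally show ?thesis .
qed

lemma poly_char_poly:
  assumes A: "(A :: complex mat) \<in> carrier_mat n n"
  shows "poly (char_poly A) x = det (x \<cdot>\<^sub>m 1\<^sub>m n - A)"
proof -
  have "- char_matrix A x = x \<cdot>\<^sub>m 1\<^sub>m n - A"
    using A by (intro eq_matI) (auto simp: char_matrix_def)
  then show ?thesis using char_poly_matrix[OF A, of x] by simp
qed

lemma poly_cancel_X_power:
  assumes "\<And>x. x ^ n * poly p x = x ^ n * poly q (x :: complex)"
  shows "p = q"
proof -
  have "poly ([:0, 1:] ^ n * p) = poly ([:0, 1:] ^ n * q)"
    using assms by (intro ext) simp
  then have "[:0, 1:] ^ n * p = [:0, 1:] ^ n * q" by (simp only: poly_eq_poly_eq_iff)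
  then show ?thesis by simp
qed

text \<open>The block matrix with blocks \<open>x, A, B, 1\<close> has determinant \<open>det (x - A B)\<close>. A factor of
  determinant \<open>x\<^sup>n\<close> makes it block triangular with determinant \<open>x\<^sup>n det (x - B A)\<close>.\<close>

lemma char_poly_mult_comm:
  assumes A: "(A :: complex mat) \<in> carrier_mat n n" and B: "B \<in> carrier_mat n n"
  shows "char_poly (A * B) = char_poly (B * A)"
proof (rule poly_cancel_X_power)
  fix x :: complex
  let ?x = "x \<cdot>\<^sub>m 1\<^sub>m n"
  let ?M = "four_block_mat ?x A B (1\<^sub>m n)"
  let ?L = "four_block_mat (1\<^sub>m n) (0\<^sub>m n n) (- B) ?x"
  have "det ?M = det (?x - A * B)"
    using A B by (subst det_four_block_mat) auto
  moreover have "det ?L = x ^ n"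
    using B by (subst det_four_block_mat_upper_right_zero[of _ n _ n]) auto
  moreover have "?L * ?M = four_block_mat ?x A (0\<^sub>m n n) (?x - B * A)"
  proof -
    have "- B * ?x + ?x * B = 0\<^sub>m n n" "- B * A + ?x * 1\<^sub>m n = ?x - B * A"
      using A B by (auto intro!: eq_matI)
    then show ?thesis
      using A B by (subst mult_four_block_mat[of _ n n _ n _ n _ _ n _ n]) auto
  qed
  moreover have "det (four_block_mat ?x A (0\<^sub>m n n) (?x - B * A)) = x ^ n * det (?x - B * A)"
    using A B by (subst det_four_block_mat_lower_left_zero[of _ n _ n]) auto
  moreover have "det (?L * ?M) = det ?L * det ?M"
    using A B by (intro det_mult[of _ "n + n"]) auto
  ultimately show "x ^ n * poly (char_poly (A * B)) x = x ^ n * poly (char_poly (B * A)) x"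
    using A B by (auto simp: poly_char_poly[of _ n])
qed

text \<open>The pseudoinverse of \<open>B\<close> may be replaced by any generalized inverse \<open>G\<close>: for a Hermitian \<open>A\<close>
  whose range lies in that of \<open>B\<close>, both \<open>A G\<close> and \<open>A B\<^sup>+\<close> turn into \<open>B\<^sup>+ A\<close> by moving one
  factor cyclically.\<close>

lemma pinv_replace:
  assumes A: "A \<in> carrier_mat n n" and B: "B \<in> carrier_mat n n" and G: "G \<in> carrier_mat n n"
    and hA: "mat_adjoint A = A" and hB: "mat_adjoint B = B"
    and rng: "mat_range A \<subseteq> mat_range B"
    and X: "is_pinv B X" and BGB: "B * G * B = B"
  shows "mat_trace (A * G) = mat_trace (A * X)" "char_poly (A * G) = char_poly (A * X)"
proof -
  note as = assoc_mult_mat[of _ n n _ n _ n] mult_carrier_mat[of _ n n _ n]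
  have Xc: "X \<in> carrier_mat n n" using X B by (auto simp: is_pinv_def)
  note x = X[unfolded is_pinv_def]
  obtain Y where Y: "Y \<in> carrier_mat n n" "A = B * Y" using rng range_subset_iff[OF A B] by blast
  have "B * X * A = B * X * B * Y" using B Xc Y by (simp add: as)
  then have BXA: "B * X * A = A" using x Y by simp
  have "mat_adjoint (B * X * A) = A * (B * X)"
    using A B Xc x by (subst adjoint_mult[of _ n n _ n]) (auto simp: as hA)
  then have ABX: "A * (B * X) = A" using BXA hA by simp
  define Z where "Z = A * mat_adjoint X"
  define W where "W = X * A * G"
  have Z: "Z \<in> carrier_mat n n" and W: "W \<in> carrier_mat n n"
    using A Xc G by (auto simp: Z_def W_def as)
  have AZ: "A = Z * B"
  proof -
    have "A * (B * X) = A * mat_adjoint (B * X)" using x by simp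
    also have "\<dots> = Z * B"
      using A B Xc by (subst adjoint_mult[of _ n n _ n]) (auto simp: Z_def as hB)
    finally show ?thesis using ABX by simp
  qed
  have BW: "A * G = B * W"
  proof -
    have "B * W = B * X * A * G" unfolding W_def using A B Xc G by (simp add: as)
    then show ?thesis using BXA by simp
  qed
  have "W * B = X * Z * (B * G * B)"
    using A B Xc G Z unfolding W_def by (subst AZ) (simp add: as)
  also have "\<dots> = X * A" unfolding BGB using B Xc Z by (subst AZ) (simp add: as)
  finally have WB: "W * B = X * A" .
  show "mat_trace (A * G) = mat_trace (A * X)"
    unfolding BW trace_mult_comm[OF B W] WB by (rule trace_mult_comm[OF Xc A])
  show "char_poly (A * G) = char_poly (A * X)"
    unfolding BW char_poly_mult_comm[OF B W] WB by (rule char_poly_mult_comm[OF Xc A])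
qed

section \<open>Volume, rank and the inequality of means\<close>

lemma order_linear_factor: "Polynomial.order a [:- b, 1:] = (if a = b then 1 else 0)" for a b :: complex
  using order_power_n_n[of b 1] by (auto intro: order_0I)

lemma prod_order_linear_factors:
  fixes X :: "complex set"
  assumes "finite X" "set as \<subseteq> X"
  shows "(\<Prod>a\<in>X. a ^ Polynomial.order a (\<Prod>b\<leftarrow>as. [:- b, 1:])) = prod_list as"
  using assms(2)
proof (induction as)
  case (Cons b as)
  let ?q = "\<Prod>b\<leftarrow>as. [:- b, 1:]"
  have nz: "?q \<noteq> 0" by (auto simp: prod_list_zero_iff)
  have "Polynomial.order a ([:- b, 1:] * ?q) = (if a = b then 1 else 0) + Polynomial.order a ?q" for a
  proof -
    have "[:- b, 1:] * ?q \<noteq> 0" using nz by (metis mult_eq_0_iff one_neq_zero pCons_eq_0_iff)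
    from order_mult[OF this, of a] show ?thesis by (simp only: order_linear_factor)
  qed
  then have "(\<Prod>a\<in>X. a ^ Polynomial.order a ([:- b, 1:] * ?q)) =
      (\<Prod>a\<in>X. (if a = b then a else 1) * a ^ Polynomial.order a ?q)"
    by (intro prod.cong) (auto simp: power_add)
  also have "\<dots> = b * prod_list as"
    using Cons assms(1) by (simp add: prod.distrib)
  finally show ?case by simp
qed simp

lemma det_eq_prod_eigenvalues:
  assumes A: "(A :: complex mat) \<in> carrier_mat n n" and X: "finite X"
    and roots: "\<And>a. poly (char_poly A) a = 0 \<Longrightarrow> a \<in> X"
  shows "det A = (\<Prod>a\<in>X. a ^ Polynomial.order a (char_poly A))"
proof -
  obtain as where as: "char_poly A = (\<Prod>a\<leftarrow>as. [:- a, 1:])" "length as = n"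
    using char_poly_factorized[OF A] by blast
  have "poly (\<Prod>a\<leftarrow>as. [:- a, 1:]) 0 = (- 1) ^ length as * prod_list as" for as :: "complex list"
    by (induction as) auto
  then have "poly (char_poly A) 0 = (- 1) ^ n * prod_list as" using as by simp
  moreover have "0 \<cdot>\<^sub>m 1\<^sub>m n - A = (- 1) \<cdot>\<^sub>m A" using A by (intro eq_matI) auto
  then have "poly (char_poly A) 0 = (- 1) ^ n * det A"
    using poly_char_poly[OF A, of 0] A by simp
  ultimately have "det A = prod_list as" by simp
  moreover have "set as \<subseteq> X"
  proof
    fix a assume "a \<in> set as"
    then have "poly (char_poly A) a = 0"
      unfolding as(1) by (induction as) auto
    then show "a \<in> X" by (rule roots)
  qed
  ultimately show ?thesis using prod_order_linear_factors[OF X, of as] as by simp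
qed

text \<open>Replacing the zero eigenvalues of a singular matrix by ones turns the volume into a
  determinant: if \<open>J\<close> projects onto \<open>m\<close> coordinates at which \<open>H\<close> has zero columns, then
  \<open>x\<^sup>m det (x - H - J) = (x - 1)\<^sup>m det (x - H)\<close>, so away from \<open>0\<close> and \<open>1\<close> the matrices \<open>H\<close>
  and \<open>H + J\<close> have the same eigenvalues with the same multiplicities.\<close>

lemma vol_eq_det:
  fixes d :: "nat \<Rightarrow> complex"
  assumes H: "H \<in> carrier_mat n n"
    and col0: "\<And>i j. i < n \<Longrightarrow> j < n \<Longrightarrow> d j = 0 \<Longrightarrow> H $$ (i, j) = 0"
    and ev: "\<And>a. eigenvalue H a \<Longrightarrow> 0 \<le> a"
    and nz: "det (H + ker_proj n d) \<noteq> 0"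
  shows "complex_of_real (mat_vol H) = det (H + ker_proj n d)"
proof -
  let ?J = "ker_proj n d"
  define p where "p = char_poly H"
  define q where "q = char_poly (H + ?J)"
  define m where "m = card {i\<in>{..<n}. d i = 0}"
  have HJ: "H + ?J \<in> carrier_mat n n" using H by simp
  have p0: "p \<noteq> 0" "q \<noteq> 0"
    unfolding p_def q_def using degree_monic_char_poly[OF H] degree_monic_char_poly[OF HJ]
    by (metis coeff_0 zero_neq_one)+
  have detS: "det (mat_diag n (\<lambda>i. if d i = 0 then y else 1)) = y ^ m" for y :: complex
    by (simp add: det_diag m_def prod.If_cases Int_def conj_commute lessThan_def)
  have "[:0, 1:] ^ m * q = [:- 1, 1:] ^ m * p"
  proof -
    have "poly ([:0, 1:] ^ m * q) x = poly ([:- 1, 1:] ^ m * p) x" for x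
    proof -
      let ?S = "mat_diag n (\<lambda>i. if d i = 0 then x else 1)"
      let ?S' = "mat_diag n (\<lambda>i. if d i = 0 then x - 1 else 1)"
      \<comment> \<open>On both sides column \<open>j\<close> is that of \<open>x - H\<close> if \<open>d j \<noteq> 0\<close>, and \<open>x (x - 1) e\<^sub>j\<close> otherwise.\<close>
      have "(x \<cdot>\<^sub>m 1\<^sub>m n - (H + ?J)) * ?S = (x \<cdot>\<^sub>m 1\<^sub>m n - H) * ?S'"
        unfolding mat_diag_mult_right[OF minus_carrier_mat[OF HJ]]
          mat_diag_mult_right[OF minus_carrier_mat[OF H]]
        using H col0 by (intro eq_matI) (auto simp: algebra_simps)
      then have "det (x \<cdot>\<^sub>m 1\<^sub>m n - (H + ?J)) * x ^ m = det (x \<cdot>\<^sub>m 1\<^sub>m n - H) * (x - 1) ^ m"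
        using det_mult[OF minus_carrier_mat[OF HJ] mat_diag_dim]
          det_mult[OF minus_carrier_mat[OF H] mat_diag_dim]
        by (metis detS)
      then show ?thesis
        using poly_char_poly[OF H] poly_char_poly[OF HJ] by (simp add: p_def q_def mult.commute)
    qed
    then have "poly ([:0, 1:] ^ m * q) = poly ([:- 1, 1:] ^ m * p)" by (intro ext)
    then show ?thesis by (simp only: poly_eq_poly_eq_iff)
  qed
  moreover have "Polynomial.order a ([:0, 1:] ^ m) = 0" "Polynomial.order a ([:- 1, 1:] ^ m) = 0"
    if "a \<noteq> 0" "a \<noteq> 1" for a :: complex
    using that by (auto intro: order_0I)
  ultimately have ord: "Polynomial.order a q = Polynomial.order a p" if "a \<noteq> 0" "a \<noteq> 1" for a
    using that p0 order_mult[of "[:0, 1:] ^ m" q a] order_mult[of "[:- 1, 1:] ^ m" p a] by simp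
  define R where "R = {a. poly p a = 0} \<union> {a. poly q a = 0}"
  have R: "finite R" unfolding R_def using p0 poly_roots_finite by auto
  have det: "det (H + ?J) = (\<Prod>a\<in>R. a ^ Polynomial.order a q)"
    unfolding q_def by (rule det_eq_prod_eigenvalues[OF HJ R]) (simp add: R_def q_def)
  have q_at_0: "a ^ Polynomial.order a q \<noteq> 0" if "a \<in> R" for a
    using nz that R unfolding det by auto
  have "(\<Prod>a\<in>R. a ^ Polynomial.order a q) =
      (\<Prod>a\<in>{a. eigenvalue H a \<and> 0 < a}. complex_of_real (Re a) ^ Polynomial.order a p)"
  proof (rule prod.mono_neutral_cong_right)
    show "{a. eigenvalue H a \<and> 0 < a} \<subseteq> R"
      using eigenvalue_root_char_poly[OF H] by (auto simp: R_def p_def)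
    show "\<forall>a\<in>R - {a. eigenvalue H a \<and> 0 < a}. a ^ Polynomial.order a q = 1"
    proof
      fix a assume a: "a \<in> R - {a. eigenvalue H a \<and> 0 < a}"
      show "a ^ Polynomial.order a q = 1"
      proof (cases "a = 0 \<or> a = 1")
        case True
        then show ?thesis using q_at_0[of a] a by (cases "Polynomial.order a q") auto
      next
        case False
        then have "\<not> eigenvalue H a" using a ev[of a] by (auto simp: less_le)
        then have "Polynomial.order a p = 0"
          using eigenvalue_root_char_poly[OF H] by (intro order_0I) (simp add: p_def)
        then show ?thesis using ord False by simp
      qed
    qed
    fix a assume "a \<in> {a. eigenvalue H a \<and> 0 < a}"
    then have "complex_of_real (Re a) = a" "a \<noteq> 0"
      by (auto simp: complex_eq_iff less_complex_def)
    then show "a ^ Polynomial.order a q = complex_of_real (Re a) ^ Polynomial.order a p"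
      using ord[of a] by (cases "a = 1") auto
  qed (fact R)
  then show ?thesis unfolding det by (simp add: mat_vol_def p_def)
qed

text \<open>An eigenvector \<open>v\<close> of \<open>M \<Delta>\<^sup>+\<close> for \<open>a \<noteq> 0\<close> lies in the range of \<open>M\<close>, hence in the support of
  \<open>\<Delta>\<close>; with \<open>w = \<Delta>\<^sup>+ v\<close>, comparing \<open>\<langle>M w, w\<rangle> \<ge> 0\<close> with \<open>a \<langle>v, w\<rangle>\<close> gives the sign of \<open>a\<close>.\<close>

lemma eigenvalue_psd_times_diag_nonneg:
  fixes d :: "nat \<Rightarrow> complex"
  assumes M: "psd_mat n M" and d: "\<And>i. i < n \<Longrightarrow> 0 \<le> d i"
    and row0: "\<And>i j. i < n \<Longrightarrow> j < n \<Longrightarrow> d i = 0 \<Longrightarrow> M $$ (i, j) = 0"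
    and ev: "eigenvalue (M * mat_diag n (\<lambda>i. inverse (d i))) a"
  shows "0 \<le> a"
proof (cases "a = 0")
  case a: False
  let ?D = "mat_diag n (\<lambda>i. inverse (d i))"
  have c: "M \<in> carrier_mat n n" using psd_carrier[OF M] .
  then obtain v where v: "v \<in> carrier_vec n" "v \<noteq> 0\<^sub>v n" "(M * ?D) *\<^sub>v v = a \<cdot>\<^sub>v v"
    using ev by (auto simp: eigenvalue_def eigenvector_def)
  define w where "w = ?D *\<^sub>v v"
  have w: "w \<in> carrier_vec n"
    unfolding w_def by (rule mult_mat_vec_carrier[OF mat_diag_dim v(1)])
  have wi: "w $ i = inverse (d i) * v $ i" if i: "i < n" for i
  proof -
    have "w $ i = (\<Sum>k = 0..<n. (if i = k then inverse (d i) else 0) * v $ k)"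
      using i v by (simp add: w_def scalar_prod_def)
    also have "\<dots> = (\<Sum>k = 0..<n. if i = k then inverse (d i) * v $ i else 0)"
      by (intro sum.cong) auto
    finally show ?thesis using i by simp
  qed
  have Mw: "M *\<^sub>v w = a \<cdot>\<^sub>v v"
    using v c by (simp add: w_def assoc_mult_mat_vec[of _ n n _ n, symmetric])
  have v0: "v $ i = 0" if i: "i < n" "d i = 0" for i
  proof -
    have "(M *\<^sub>v w) $ i = 0" using i row0 c w by (auto simp: scalar_prod_def intro!: sum.neutral)
    then show ?thesis using a v i by (simp add: Mw)
  qed
  define s where "s = (\<Sum>i = 0..<n. (cmod (v $ i))\<^sup>2 / Re (d i))"
  have di: "d i = complex_of_real (Re (d i))" "0 \<le> Re (d i)" if "i < n" for i
    using d[OF that] by (auto simp: complex_eq_iff less_eq_complex_def)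
  have "v \<bullet>c w = complex_of_real s"
  proof -
    have "v \<bullet>c w = (\<Sum>i = 0..<n. v $ i * cnj (w $ i))" using v(1) w by (rule cscalar_eq_sum)
    also have "\<dots> = (\<Sum>i = 0..<n. complex_of_real ((cmod (v $ i))\<^sup>2 / Re (d i)))"
    proof (intro sum.cong refl)
      fix i assume "i \<in> {0..<n}"
      then have i: "i < n" by simp
      have "v $ i * cnj (w $ i) = v $ i * cnj (v $ i) * inverse (cnj (d i))"
        by (simp add: wi[OF i])
      also have "cnj (d i) = complex_of_real (Re (d i))" by (subst di(1)[OF i]) simp
      finally show "v $ i * cnj (w $ i) = complex_of_real ((cmod (v $ i))\<^sup>2 / Re (d i))"
        by (simp only: divide_inverse of_real_mult of_real_inverse complex_norm_square)
    qed
    finally show ?thesis by (simp add: s_def)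
  qed
  then have Ms: "(M *\<^sub>v w) \<bullet>c w = a * complex_of_real s" using v w by (simp add: Mw)
  have "s > 0"
  proof -
    obtain i where i: "i < n" "v $ i \<noteq> 0"
      using v by (metis carrier_vecD eq_vecI index_zero_vec(1) index_zero_vec(2))
    then have "d i \<noteq> 0" using v0 by blast
    then have "Re (d i) \<noteq> 0" using di(1)[OF i(1)] by auto
    then have "0 < (cmod (v $ i))\<^sup>2 / Re (d i)" using i di(2)[OF i(1)] by auto
    also have "\<dots> \<le> s"
      unfolding s_def using i di by (intro member_le_sum) auto
    finally show ?thesis .
  qed
  moreover have "0 \<le> a * complex_of_real s" using psd_nonneg[OF M w] Ms by simp
  ultimately show ?thesis by (auto simp: less_eq_complex_def zero_le_mult_iff)
qed simp

text \<open>The columns of \<open>W\<close> over the support of \<open>d\<close> form a basis of the column space.\<close>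

lemma rank_diag_equivalence:
  fixes d :: "nat \<Rightarrow> complex"
  assumes W: "W \<in> carrier_mat n n" and Z: "Z \<in> carrier_mat n n"
    and dW: "det W \<noteq> 0" and dZ: "det Z \<noteq> 0"
  shows "vec_space.rank n (W * mat_diag n d * Z) = card {i\<in>{..<n}. d i \<noteq> 0}"
proof -
  interpret vs: vec_space "TYPE(complex)" n .
  let ?D = "mat_diag n d" and ?E = "supp_proj n d"
  define A where "A = W * ?D * Z"
  define I where "I = {i\<in>{..<n}. d i \<noteq> 0}"
  define U where "U = col W ` I"
  have A: "A \<in> carrier_mat n n" using W Z by (simp add: A_def mult_carrier_mat[of _ n n _ n])
  have Uc: "U \<subseteq> carrier_vec n" using W by (auto simp: U_def I_def)
  have "distinct (cols W)"
    using det_identical_cols[OF W] dW W by (auto simp: distinct_conv_nth)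
  then have inj: "inj_on (col W) I"
    using W unfolding distinct_conv_nth
    by (intro inj_onI) (metis I_def carrier_matD(2) cols_length cols_nth lessThan_iff mem_Collect_eq)
  have Ucols: "U \<subseteq> set (cols W)" using W by (auto simp: U_def I_def cols_def)
  have "vs.lin_indpt (set (cols W))" using vs.lin_dep_cols_imp_det_0[OF W] dW by blast
  then have Uli: "vs.lin_indpt U" using Ucols vs.subset_li_is_li by blast
  have span: "vs.span (set (cols A)) = vs.span U"
  proof (rule antisym)
    show "vs.span (set (cols A)) \<subseteq> vs.span U"
    proof
      fix y assume "y \<in> vs.span (set (cols A))"
      then obtain x where x: "x \<in> carrier_vec n" "y = A *\<^sub>v x"
        using vs.col_space_eq[OF A] A by (auto simp: vs.col_space_def)
      define B where "B = W * ?E"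
      have B: "B \<in> carrier_mat n n" using W by (simp add: B_def mult_carrier_mat[of _ n n _ n])
      have "?E * ?D = ?D" by (auto intro!: diag_cong)
      then have "A = W * (?E * ?D) * Z" by (simp add: A_def)
      also have "\<dots> = B * (?D * Z)"
        using W Z unfolding B_def
        by (simp only: assoc_mult_mat[of _ n n _ n _ n] mult_carrier_mat[of _ n n _ n] mat_diag_dim)
      finally have "A = B * (?D * Z)" .
      then have "y = B *\<^sub>v ((?D * Z) *\<^sub>v x)"
        using x B Z by (simp add: assoc_mult_mat_vec[of _ n n _ n] mult_carrier_mat[of _ n n _ n])
      moreover have "(?D * Z) *\<^sub>v x \<in> carrier_vec n"
        using x Z by (simp add: mult_carrier_mat[of _ n n _ n] mult_mat_vec_carrier[of _ n n])
      ultimately have "y \<in> vs.span (set (cols B))"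
        using vs.col_space_eq[OF B] B by (auto simp: vs.col_space_def)
      moreover have "set (cols B) \<subseteq> vs.span U"
      proof
        fix u assume "u \<in> set (cols B)"
        then obtain j where j: "j < n" "u = col B j" using B by (auto simp: cols_def)
        show "u \<in> vs.span U"
        proof (cases "d j = 0")
          case True
          then have "u = 0\<^sub>v n"
            using j W unfolding B_def by (intro eq_vecI) (auto simp: mat_diag_mult_right[of _ n n])
          then show ?thesis using vs.span_is_monotone[of "{}" U] vs.span_empty by auto
        next
          case False
          then have "u = col W j"
            using j W unfolding B_def by (intro eq_vecI) (auto simp: mat_diag_mult_right[of _ n n])
          then have "u \<in> U" using j False by (auto simp: U_def I_def)
          then show ?thesis using Uc vs.span_mem by blast
        qed
      qed
      ultimately show "y \<in> vs.span U" using vs.span_subsetI[OF Uc] by blast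
    qed
    obtain Zi where Zi: "Zi \<in> carrier_mat n n" "Z * Zi = 1\<^sub>m n"
      using inverse_of_det_nonzero[OF Z dZ] by blast
    have "U \<subseteq> vs.span (set (cols A))"
    proof
      fix u assume "u \<in> U"
      then obtain i where i: "i < n" "d i \<noteq> 0" "u = col W i" by (auto simp: U_def I_def)
      define x where "x = Zi *\<^sub>v (inverse (d i) \<cdot>\<^sub>v unit_vec n i)"
      have x: "x \<in> carrier_vec n" using Zi by (simp add: x_def)
      have "Z *\<^sub>v x = inverse (d i) \<cdot>\<^sub>v unit_vec n i"
        unfolding x_def using Z Zi by (subst assoc_mult_mat_vec[of _ n n _ n, symmetric]) auto
      moreover have "?D *\<^sub>v (inverse (d i) \<cdot>\<^sub>v unit_vec n i) = unit_vec n i"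
        using i by (intro eq_vecI) (auto simp: mult_mat_vec[of _ n n])
      moreover have "W *\<^sub>v unit_vec n i = u"
        using i W by (intro eq_vecI) auto
      ultimately have "A *\<^sub>v x = u"
        using W Z x unfolding A_def
        by (simp add: assoc_mult_mat_vec[of _ n n _ n] mult_carrier_mat[of _ n n _ n])
      then show "u \<in> vs.span (set (cols A))"
        using vs.col_space_eq[OF A] A x Uc \<open>u \<in> U\<close> by (auto simp: vs.col_space_def)
    qed
    then show "vs.span U \<subseteq> vs.span (set (cols A))"
      using vs.span_subsetI[of "set (cols A)" U] A cols_dim[of A] by auto
  qed
  have "vs.rank A = vectorspace.dim class_ring (vs.span_vs U)"
    unfolding vs.rank_def span ..
  also have "\<dots> = card U"
    using Uc Uli by (intro vs.dim_span) (auto simp: maximal_def U_def I_def)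
  also have "\<dots> = card I" unfolding U_def by (rule card_image[OF inj])
  finally show ?thesis by (simp add: A_def I_def)
qed

lemma prod_le_mean_power:
  fixes a :: "'i \<Rightarrow> real"
  assumes fin: "finite I" and a: "\<And>i. i \<in> I \<Longrightarrow> 0 \<le> a i"
  shows "(\<Prod>i\<in>I. a i) \<le> ((\<Sum>i\<in>I. a i) / card I) ^ card I"
proof (cases "I = {}")
  case False
  let ?p = "\<Prod>i\<in>I. a i"
  have c: "card I > 0" using fin False by (simp add: card_gt_0_iff)
  have p: "0 \<le> ?p" using a by (intro prod_nonneg) auto
  have "?p powr (1 / card I) \<le> (\<Sum>i\<in>I. a i) / card I"
    using arith_geom_mean[OF fin False a] by (simp add: sum_divide_distrib)
  then have "(?p powr (1 / card I)) ^ card I \<le> ((\<Sum>i\<in>I. a i) / card I) ^ card I"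
    by (intro power_mono) auto
  moreover have "(?p powr (1 / card I)) ^ card I = ?p"
    using p c by (cases "?p = 0") (auto simp: powr_powr powr_realpow[symmetric])
  ultimately show ?thesis by simp
qed simp

section \<open>Congruence, ranges and the Kaporin number of a factored approximation\<close>

lemma det_nonzero_of_inverse:
  assumes "(K :: complex mat) \<in> carrier_mat n n" "L \<in> carrier_mat n n" "K * L = 1\<^sub>m n"
  shows "det K \<noteq> 0" "det L \<noteq> 0"
  using det_mult[OF assms(1,2)] assms(3) by auto

lemma adjoint_inverse:
  assumes "(K :: complex mat) \<in> carrier_mat n n" "L \<in> carrier_mat n n" "K * L = 1\<^sub>m n"
  shows "mat_adjoint L * mat_adjoint K = 1\<^sub>m n"
proof -
  have "mat_adjoint (1\<^sub>m n :: complex mat) = 1\<^sub>m n" by (intro eq_matI) auto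
  then show ?thesis using adjoint_mult[OF assms(1,2)] assms(3) by simp
qed

lemma mult_inverse_cancel:
  assumes "(K :: complex mat) \<in> carrier_mat n n" "L \<in> carrier_mat n n" "K * L = 1\<^sub>m n"
    and "Z \<in> carrier_mat n n"
  shows "K * (L * Z) = Z"
  using assoc_mult_mat[OF assms(1,2,4)] assms(3,4) by simp

lemma congruence_inverse:
  assumes K: "(K :: complex mat) \<in> carrier_mat n n" and L: "L \<in> carrier_mat n n"
    and KL: "K * L = 1\<^sub>m n" and A: "A \<in> carrier_mat n n"
  shows "K * (L * A * mat_adjoint L) * mat_adjoint K = A"
proof -
  have c: "mat_adjoint K \<in> carrier_mat n n" "mat_adjoint L \<in> carrier_mat n n" using K L by auto
  have "K * (L * A * mat_adjoint L) * mat_adjoint K = K * (L * (A * (mat_adjoint L * mat_adjoint K)))"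
    by (simp only: assoc_mult_mat[of _ n n _ n _ n] mult_carrier_mat[of _ n n _ n] K L A c)
  also have "\<dots> = A"
    using A mult_inverse_cancel[OF K L KL A] by (simp add: adjoint_inverse[OF K L KL])
  finally show ?thesis .
qed

text \<open>If \<open>A = B X\<close>, then \<open>L A L\<^sup>* = (L B L\<^sup>*) (K\<^sup>* X L\<^sup>*)\<close>.\<close>

lemma range_congruence_subset:
  assumes K: "(K :: complex mat) \<in> carrier_mat n n" and L: "L \<in> carrier_mat n n"
    and KL: "K * L = 1\<^sub>m n"
    and A: "A \<in> carrier_mat n n" and B: "B \<in> carrier_mat n n"
    and sub: "mat_range A \<subseteq> mat_range B"
  shows "mat_range (L * A * mat_adjoint L) \<subseteq> mat_range (L * B * mat_adjoint L)"
proof -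
  have c: "mat_adjoint K \<in> carrier_mat n n" "mat_adjoint L \<in> carrier_mat n n" using K L by auto
  obtain X where X: "X \<in> carrier_mat n n" "A = B * X" using sub range_subset_iff[OF A B] by blast
  note car = assoc_mult_mat[of _ n n _ n _ n] mult_carrier_mat[of _ n n _ n] K L B c X(1)
  have "L * B * mat_adjoint L * (mat_adjoint K * X * mat_adjoint L) =
      L * (B * (mat_adjoint L * (mat_adjoint K * (X * mat_adjoint L))))"
    by (simp only: car)
  also have "\<dots> = L * (B * (X * mat_adjoint L))"
    using mult_inverse_cancel[OF c(2,1) adjoint_inverse[OF K L KL]] by (simp only: car)
  also have "\<dots> = L * A * mat_adjoint L"
    unfolding X(2) by (simp only: car)
  finally have "L * A * mat_adjoint L = L * B * mat_adjoint L * (mat_adjoint K * X * mat_adjoint L)" ..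
  moreover have "mat_adjoint K * X * mat_adjoint L \<in> carrier_mat n n"
    "L * A * mat_adjoint L \<in> carrier_mat n n" "L * B * mat_adjoint L \<in> carrier_mat n n"
    by (simp_all only: car A)
  ultimately show ?thesis using range_subset_iff[of "L * A * mat_adjoint L" n] by blast
qed

lemma range_congruence_eq_iff:
  assumes K: "(K :: complex mat) \<in> carrier_mat n n" and L: "L \<in> carrier_mat n n"
    and KL: "K * L = 1\<^sub>m n" and LK: "L * K = 1\<^sub>m n"
    and A: "A \<in> carrier_mat n n" and N: "N \<in> carrier_mat n n"
  shows "mat_range A = mat_range (K * N * mat_adjoint K) \<longleftrightarrow>
    mat_range (L * A * mat_adjoint L) = mat_range N"
proof -
  have c: "mat_adjoint K \<in> carrier_mat n n" "mat_adjoint L \<in> carrier_mat n n" using K L by auto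
  have M: "L * A * mat_adjoint L \<in> carrier_mat n n" "K * N * mat_adjoint K \<in> carrier_mat n n"
    by (simp_all only: mult_carrier_mat[of _ n n _ n] K L A N c)
  note inv = congruence_inverse[OF L K LK N] congruence_inverse[OF K L KL A]
  show ?thesis
    using range_congruence_subset[OF K L KL A M(2)] range_congruence_subset[OF K L KL M(2) A]
      range_congruence_subset[OF L K LK M(1) N] range_congruence_subset[OF L K LK N M(1)]
    unfolding inv by blast
qed

lemma range_diag_iff:
  fixes d :: "nat \<Rightarrow> complex"
  assumes M: "M \<in> carrier_mat n n"
  shows "mat_range M \<subseteq> mat_range (mat_diag n d) \<longleftrightarrow>
    (\<forall>i<n. \<forall>j<n. d i = 0 \<longrightarrow> M $$ (i, j) = 0)"
proof
  assume "mat_range M \<subseteq> mat_range (mat_diag n d)"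
  then obtain X where "X \<in> carrier_mat n n" "M = mat_diag n d * X"
    using range_subset_iff[OF M mat_diag_dim] by blast
  then show "\<forall>i<n. \<forall>j<n. d i = 0 \<longrightarrow> M $$ (i, j) = 0"
    by (auto simp: mat_diag_mult_left[of _ n n])
next
  assume z: "\<forall>i<n. \<forall>j<n. d i = 0 \<longrightarrow> M $$ (i, j) = 0"
  define X where "X = mat_diag n (\<lambda>i. inverse (d i)) * M"
  have X: "X \<in> carrier_mat n n" using M by (simp add: X_def mult_carrier_mat[of _ n n _ n])
  have "M = mat_diag n d * X"
    using z M unfolding mat_diag_mult_left[OF X] unfolding X_def mat_diag_mult_left[OF M]
    by (intro eq_matI) (auto, metis right_inverse)
  then show "mat_range M \<subseteq> mat_range (mat_diag n d)"
    using range_subset_iff[OF M mat_diag_dim] X by blast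
qed

lemma vol_cong_char_poly:
  assumes "A \<in> carrier_mat n n" "B \<in> carrier_mat n n" "char_poly A = char_poly B"
  shows "mat_vol A = mat_vol B"
  using assms eigenvalue_root_char_poly[of A n] eigenvalue_root_char_poly[of B n]
  by (simp add: mat_vol_def)

text \<open>The matrix \<open>G = L\<^sup>* \<Delta>\<^sup>+ L\<close> is a generalized inverse of \<open>B = K \<Delta> K\<^sup>*\<close> for \<open>L = K\<^sup>-\<^sup>1\<close>, though
  in general not the pseudoinverse. Trace and volume of \<open>A B\<^sup>+\<close> are those of \<open>A G\<close>, and
  moving \<open>L\<close> to the front turns \<open>A G\<close> into \<open>(L A L\<^sup>*) \<Delta>\<^sup>+\<close>.\<close>

lemma kaporin_congruence:
  fixes d :: "nat \<Rightarrow> complex"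
  assumes A: "psd_mat n A" and K: "K \<in> carrier_mat n n" and L: "L \<in> carrier_mat n n"
    and KL: "K * L = 1\<^sub>m n" and LK: "L * K = 1\<^sub>m n"
    and d: "\<And>i. i < n \<Longrightarrow> 0 \<le> d i"
    and rng: "mat_range A = mat_range (K * mat_diag n d * mat_adjoint K)"
  shows "kaporin A (K * mat_diag n d * mat_adjoint K) =
    ereal ((Re (mat_trace (L * A * mat_adjoint L * mat_diag n (\<lambda>i. inverse (d i)))) /
        real (vec_space.rank n A)) ^ vec_space.rank n A /
      mat_vol (L * A * mat_adjoint L * mat_diag n (\<lambda>i. inverse (d i))))"
proof -
  define \<Delta> where "\<Delta> = mat_diag n d"
  define \<Delta>i where "\<Delta>i = mat_diag n (\<lambda>i. inverse (d i))"
  define B where "B = K * \<Delta> * mat_adjoint K"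
  define G where "G = mat_adjoint L * \<Delta>i * L"
  have Ac: "A \<in> carrier_mat n n" using psd_carrier[OF A] .
  have c: "mat_adjoint K \<in> carrier_mat n n" "mat_adjoint L \<in> carrier_mat n n"
    "\<Delta> \<in> carrier_mat n n" "\<Delta>i \<in> carrier_mat n n" using K L by (auto simp: \<Delta>_def \<Delta>i_def)
  note car = assoc_mult_mat[of _ n n _ n _ n] mult_carrier_mat[of _ n n _ n] K L Ac c
  have B: "B \<in> carrier_mat n n" and G: "G \<in> carrier_mat n n"
    by (simp_all only: B_def G_def car)
  have hD: "mat_adjoint \<Delta> = \<Delta>"
    unfolding \<Delta>_def adjoint_diag using d
    by (intro diag_cong) (auto simp: complex_eq_iff less_eq_complex_def)
  have hB: "mat_adjoint B = B"
    unfolding B_def by (simp only: adjoint_mult[of _ n n _ n] adjoint_adjoint hD car)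
  obtain X where X: "is_pinv B X"
    using is_pinv_congruence[OF K det_nonzero_of_inverse(1)[OF K L KL], of d]
    by (auto simp: B_def \<Delta>_def)
  then have Xc: "X \<in> carrier_mat n n" using B by (auto simp: is_pinv_def)
  have BGB: "B * G * B = B"
  proof -
    have "B * G * B =
        K * (\<Delta> * (mat_adjoint K * (mat_adjoint L * (\<Delta>i * (L * (K * (\<Delta> * mat_adjoint K)))))))"
      unfolding B_def G_def by (simp only: car)
    also have "\<dots> = K * (\<Delta> * (\<Delta>i * (\<Delta> * mat_adjoint K)))"
      using mult_inverse_cancel[OF L K LK] mult_inverse_cancel[OF c(1,2) adjoint_inverse[OF L K LK]]
      by (simp only: car)
    also have "\<dots> = K * ((\<Delta> * \<Delta>i * \<Delta>) * mat_adjoint K)" by (simp only: car)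
    also have "\<Delta> * \<Delta>i * \<Delta> = \<Delta>"
      unfolding \<Delta>_def \<Delta>i_def mat_diag_diag
      by (intro diag_cong) (metis mult_1 mult_zero_left right_inverse)
    finally show ?thesis unfolding B_def by (simp only: car)
  qed
  define H where "H = L * A * mat_adjoint L * \<Delta>i"
  define Y where "Y = A * mat_adjoint L * \<Delta>i"
  have Y: "Y \<in> carrier_mat n n" and H: "H \<in> carrier_mat n n" by (simp_all only: Y_def H_def car)
  have YL: "A * G = Y * L" and LY: "L * Y = H" unfolding G_def Y_def H_def by (simp_all only: car)
  have AX: "A * X \<in> carrier_mat n n" using Ac Xc by (rule mult_carrier_mat)
  have "mat_range A \<subseteq> mat_range B" using rng by (simp add: B_def \<Delta>_def)
  note pr = pinv_replace[OF Ac B G psd_adjoint[OF A] hB this X BGB]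
  have "mat_trace (A * X) = mat_trace H"
    using pr(1) trace_mult_comm[OF Y L] unfolding YL LY by simp
  moreover have "mat_vol (A * X) = mat_vol H"
    using pr(2) char_poly_mult_comm[OF Y L] unfolding YL LY
    by (intro vol_cong_char_poly[OF AX H]) simp
  moreover have "pinv B = X" by (rule pinv_eqI[OF B X])
  ultimately have "kaporin A B = ereal ((Re (mat_trace H) / real (vec_space.rank n A)) ^
      vec_space.rank n A / mat_vol H)"
    using rng Ac by (simp add: kaporin_def B_def \<Delta>_def Let_def)
  then show ?thesis by (simp add: B_def \<Delta>_def H_def \<Delta>i_def)
qed

section \<open>Unit lower triangular matrices\<close>

definition unit_lower :: "nat \<Rightarrow> complex mat \<Rightarrow> bool" where
  "unit_lower n U \<longleftrightarrow> U \<in> carrier_mat n n \<and> (\<forall>i<n. U $$ (i, i) = 1) \<and>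
     (\<forall>i<n. \<forall>j<n. i < j \<longrightarrow> U $$ (i, j) = 0)"

lemma det_unit_lower: "unit_lower n U \<Longrightarrow> det U = 1"
  by (subst det_lower_triangular[of n]) (auto simp: unit_lower_def prod_list_diag_prod)

lemma det_adjoint_unit_lower:
  assumes "unit_lower n U" shows "det (mat_adjoint U) = 1"
proof -
  let ?V = "mat n n (\<lambda>(i, j). cnj (U $$ (i, j)))"
  have "unit_lower n ?V" using assms by (auto simp: unit_lower_def)
  moreover have "mat_adjoint U = transpose_mat ?V"
    using assms by (intro eq_matI) (auto simp: unit_lower_def)
  ultimately show ?thesis using det_unit_lower[of n ?V] det_transpose[of ?V n] by simp
qed

lemma unit_lower_mult:
  assumes U: "unit_lower n U" and V: "unit_lower n V"
  shows "unit_lower n (U * V)"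
proof -
  have c: "U \<in> carrier_mat n n" "V \<in> carrier_mat n n" using U V by (auto simp: unit_lower_def)
  have "(U * V) $$ (i, j) = (if i = j then 1 else 0)" if ij: "i < n" "j < n" "i \<le> j" for i j
  proof -
    have "(U * V) $$ (i, j) = (\<Sum>k = 0..<n. U $$ (i, k) * V $$ (k, j))"
      using c ij by (simp add: scalar_prod_def)
    also have "\<dots> = (\<Sum>k = 0..<n. if k = i then (if i = j then 1 else 0) else 0)"
    proof (intro sum.cong refl)
      fix k assume "k \<in> {0..<n}"
      then show "U $$ (i, k) * V $$ (k, j) = (if k = i then (if i = j then 1 else 0) else 0)"
        using U V ij by (cases k i rule: linorder_cases) (auto simp: unit_lower_def)
    qed
    finally show ?thesis using ij by simp
  qed
  then show ?thesis using c by (auto simp: unit_lower_def simp del: index_mult_mat)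
qed

text \<open>Forward substitution: the entries of the inverse on and above the diagonal are determined row
  by row.\<close>

lemma unit_lower_inverse:
  assumes U: "unit_lower n U" and X: "X \<in> carrier_mat n n" and UX: "U * X = 1\<^sub>m n"
  shows "unit_lower n X"
proof -
  have c: "U \<in> carrier_mat n n" using U by (auto simp: unit_lower_def)
  have "i < n \<Longrightarrow> \<forall>j<n. i \<le> j \<longrightarrow> X $$ (i, j) = (if i = j then 1 else 0)" for i
  proof (induction i rule: less_induct)
    case (less i)
    show ?case
    proof (intro allI impI)
      fix j assume j: "j < n" "i \<le> j"
      have "(if i = j then 1 else 0) = (\<Sum>k = 0..<n. U $$ (i, k) * X $$ (k, j))"
        using arg_cong[OF UX, of "\<lambda>M. M $$ (i, j)"] c X less.prems j by (simp add: scalar_prod_def)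
      also have "\<dots> = (\<Sum>k = 0..<n. if k = i then X $$ (i, j) else 0)"
      proof (intro sum.cong refl)
        fix k assume "k \<in> {0..<n}"
        then have k: "k < n" by simp
        show "U $$ (i, k) * X $$ (k, j) = (if k = i then X $$ (i, j) else 0)"
          using U k j less.prems less.IH[of k]
          by (cases k i rule: linorder_cases) (auto simp: unit_lower_def)
      qed
      finally show "X $$ (i, j) = (if i = j then 1 else 0)" using less.prems by simp
    qed
  qed
  then show ?thesis using X by (auto simp: unit_lower_def)
qed

text \<open>With \<open>E\<close> and \<open>J\<close> the projections onto the support and the kernel of \<open>W\<close>, the matrix
  \<open>U W U\<^sup>* + J\<close> factors as \<open>(U E + J) (W + J) (U E + J)\<^sup>*\<close>, and \<open>U E + J\<close> is again unit lower
  triangular.\<close>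

lemma det_plus_ker_proj:
  fixes w :: "nat \<Rightarrow> complex"
  assumes U: "unit_lower n U"
  shows "det (U * mat_diag n w * mat_adjoint U + ker_proj n w) = (\<Prod>i<n. if w i = 0 then 1 else w i)"
proof -
  define V where "V = mat n n (\<lambda>(i, j). if w j = 0 then (if i = j then 1 else 0) else U $$ (i, j))"
  let ?f = "\<lambda>i. if w i = 0 then 1 else w i"
  have c: "U \<in> carrier_mat n n" "V \<in> carrier_mat n n" using U by (auto simp: unit_lower_def V_def)
  have V: "unit_lower n V" using U by (auto simp: unit_lower_def V_def)
  have "U * mat_diag n w * mat_adjoint U + ker_proj n w = V * mat_diag n ?f * mat_adjoint V"
  proof (rule eq_matI)
    fix i j assume "i < dim_row (V * mat_diag n ?f * mat_adjoint V)"
      "j < dim_col (V * mat_diag n ?f * mat_adjoint V)"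
    then have ij: "i < n" "j < n" using c by auto
    have e: "(Z * mat_diag n f * mat_adjoint Z) $$ (i, j) =
        (\<Sum>k = 0..<n. Z $$ (i, k) * f k * cnj (Z $$ (j, k)))" if "Z \<in> carrier_mat n n" for Z f
      using that ij by (simp add: mat_diag_mult_right[OF that] scalar_prod_def)
    have "(U * mat_diag n w * mat_adjoint U + ker_proj n w) $$ (i, j) =
        (\<Sum>k = 0..<n. U $$ (i, k) * w k * cnj (U $$ (j, k))) +
        (\<Sum>k = 0..<n. if k = i then (if i = j \<and> w i = 0 then 1 else 0) else 0)"
      using ij c by (simp add: e[OF c(1)] del: index_mult_mat(1))
    also have "\<dots> = (\<Sum>k = 0..<n. V $$ (i, k) * ?f k * cnj (V $$ (j, k)))"
      unfolding sum.distrib[symmetric] using ij by (intro sum.cong) (auto simp: V_def)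
    finally show "(U * mat_diag n w * mat_adjoint U + ker_proj n w) $$ (i, j) =
        (V * mat_diag n ?f * mat_adjoint V) $$ (i, j)"
      unfolding e[OF c(2)] .
  qed (use c in auto)
  moreover have "det (V * mat_diag n ?f * mat_adjoint V) =
      det V * det (mat_diag n ?f) * det (mat_adjoint V)"
    using c(2) by (simp add: det_mult[of _ n] mult_carrier_mat[of _ n n _ n])
  ultimately show ?thesis
    by (simp only: det_unit_lower[OF V] det_adjoint_unit_lower[OF V] det_diag mult_1_left mult_1_right)
qed

section \<open>Cholesky factors by projection\<close>

text \<open>For the covariance matrix \<open>T\<close> of a Gaussian vector this is the conditional variance of the
  \<open>i\<close>-th variable given the variables in \<open>K\<close>.\<close>

definition cond_var :: "nat \<Rightarrow> complex mat \<Rightarrow> nat \<Rightarrow> nat set \<Rightarrow> real" where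
  "cond_var n T i K = (mat_setdist T (unit_vec n i) (cspan n (unit_vec n ` K)))\<^sup>2"

lemma cond_var_nonneg: "0 \<le> cond_var n T i K"
  by (simp add: cond_var_def)

lemma cond_var_attained:
  assumes "psd_mat n T" "K \<subseteq> {..<n}"
  shows "\<exists>x \<in> carrier_vec n. (\<forall>j<n. j \<notin> K \<longrightarrow> x $ j = unit_vec n i $ j) \<and>
    (\<forall>j\<in>K. (T *\<^sub>v x) $ j = 0) \<and> cond_var n T i K = Re ((T *\<^sub>v x) \<bullet>c x)"
proof -
  obtain g where g: "g \<in> carrier_vec n" "\<forall>j<n. j \<notin> K \<longrightarrow> g $ j = 0"
    "\<forall>j\<in>K. (T *\<^sub>v (unit_vec n i + g)) $ j = 0"
    using psd_projection[OF assms unit_vec_carrier, of i] by blast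
  define x where "x = unit_vec n i + g"
  have x: "x \<in> carrier_vec n" "\<And>j. j < n \<Longrightarrow> j \<notin> K \<Longrightarrow> x $ j = unit_vec n i $ j"
    "\<And>j. j \<in> K \<Longrightarrow> (T *\<^sub>v x) $ j = 0"
    using g by (auto simp: x_def simp del: index_mult_mat_vec)
  from setdist_sq_eq[OF assms unit_vec_carrier x] x show ?thesis
    unfolding cond_var_def by blast
qed

lemma cond_var_antimono:
  assumes "psd_mat n T" "K \<subseteq> L" "L \<subseteq> {..<n}"
  shows "cond_var n T i L \<le> cond_var n T i K"
proof -
  have "K \<subseteq> {..<n}" using assms by blast
  from cond_var_attained[OF assms(1) this, of i]
  obtain x where x: "x \<in> carrier_vec n" "\<forall>j<n. j \<notin> K \<longrightarrow> x $ j = unit_vec n i $ j"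
    "cond_var n T i K = Re ((T *\<^sub>v x) \<bullet>c x)" by blast
  have "x $ j = unit_vec n i $ j" if "j < n" "j \<notin> L" for j
    using that x(2) assms(2) by blast
  then show ?thesis
    unfolding x(3) unfolding cond_var_def
    by (intro setdist_sq_le[OF assms(1,3) unit_vec_carrier x(1)])
qed

lemma gram_index:
  assumes C: "C \<in> carrier_mat n n" and T: "T \<in> carrier_mat n n" and ij: "i < n" "j < n"
  shows "(C * T * mat_adjoint C) $$ (i, j) =
    (T *\<^sub>v col (mat_adjoint C) j) \<bullet>c col (mat_adjoint C) i"
proof -
  have c: "mat_adjoint C \<in> carrier_mat n n" "T * mat_adjoint C \<in> carrier_mat n n"
    using C T by (auto intro: mult_carrier_mat)
  have "C * T * mat_adjoint C = C * (T * mat_adjoint C)"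
    using C T c by (intro assoc_mult_mat) auto
  also have "\<dots> $$ (i, j) = row C i \<bullet> col (T * mat_adjoint C) j"
    using C c ij by simp
  also have "col (T * mat_adjoint C) j = T *\<^sub>v col (mat_adjoint C) j"
    using T c ij by (intro col_mult2) auto
  also have "row C i = conjugate (col (mat_adjoint C) i)"
    using C ij by (intro eq_vecI) auto
  also have "\<dots> \<bullet> (T *\<^sub>v col (mat_adjoint C) j) = (T *\<^sub>v col (mat_adjoint C) j) \<bullet>c col (mat_adjoint C) i"
    using C T ij by (intro comm_scalar_prod[of _ n]) (auto intro!: carrier_vecI)
  finally show ?thesis .
qed

lemma psd_form_real:
  assumes "psd_mat n T" "x \<in> carrier_vec n"
  shows "(T *\<^sub>v x) \<bullet>c x = complex_of_real (Re ((T *\<^sub>v x) \<bullet>c x))"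
  using psd_nonneg[OF assms] by (simp add: complex_eq_iff less_eq_complex_def)

text \<open>Row \<open>i\<close> of the factor is obtained by projecting \<open>e\<^sub>i\<close> along the span of the earlier unit
  vectors; orthogonality to the earlier coordinates makes the Gram matrix of the rows
  diagonal.\<close>

lemma cholesky_exists:
  assumes T: "psd_mat n T"
  shows "\<exists>C. unit_lower n C \<and>
    C * T * mat_adjoint C = mat_diag n (\<lambda>i. complex_of_real (cond_var n T i {j. j < i}))"
proof -
  have Tc: "T \<in> carrier_mat n n" using psd_carrier[OF T] .
  define Q where "Q = (\<lambda>i x. x \<in> carrier_vec n \<and>
      (\<forall>j<n. j \<notin> {j. j < i} \<longrightarrow> x $ j = unit_vec n i $ j) \<and>
      (\<forall>j\<in>{j. j < i}. (T *\<^sub>v x) $ j = 0) \<and> cond_var n T i {j. j < i} = Re ((T *\<^sub>v x) \<bullet>c x))"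
  define x where "x = (\<lambda>i. SOME x. Q i x)"
  have Qx: "Q i (x i)" if "i < n" for i
  proof -
    have "{j. j < i} \<subseteq> {..<n}" using that by auto
    from cond_var_attained[OF T this, of i] have "\<exists>x. Q i x" unfolding Q_def by blast
    then show ?thesis unfolding x_def by (rule someI_ex)
  qed
  have x: "\<And>i. i < n \<Longrightarrow> x i \<in> carrier_vec n"
    "\<And>i j. i < n \<Longrightarrow> j < n \<Longrightarrow> \<not> j < i \<Longrightarrow> x i $ j = unit_vec n i $ j"
    "\<And>i j. i < n \<Longrightarrow> j < i \<Longrightarrow> (T *\<^sub>v x i) $ j = 0"
    "\<And>i. i < n \<Longrightarrow> cond_var n T i {j. j < i} = Re ((T *\<^sub>v x i) \<bullet>c x i)"
    using Qx unfolding Q_def by (simp_all del: index_mult_mat_vec)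
  define C where "C = mat n n (\<lambda>(i, j). cnj (x i $ j))"
  have C: "C \<in> carrier_mat n n" by (simp add: C_def)
  have col: "col (mat_adjoint C) i = x i" if "i < n" for i
    using that x(1)[OF that] by (intro eq_vecI) (auto simp: C_def)
  have "unit_lower n C" using x(2) by (auto simp: unit_lower_def C_def)
  moreover have "C * T * mat_adjoint C = mat_diag n (\<lambda>i. complex_of_real (cond_var n T i {j. j < i}))"
  proof (rule eq_matI)
    fix i j
    assume "i < dim_row (mat_diag n (\<lambda>i. complex_of_real (cond_var n T i {j. j < i})))"
      "j < dim_col (mat_diag n (\<lambda>i. complex_of_real (cond_var n T i {j. j < i})))"
    then have ij: "i < n" "j < n" by auto
    have orth: "(T *\<^sub>v x b) \<bullet>c x a = 0" if "a < b" "b < n" for a b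
    proof (rule cscalar_supported[of _ n])
      fix k assume k: "k < n"
      show "(T *\<^sub>v x b) $ k = 0 \<or> x a $ k = 0"
      proof (cases "k < b")
        case True
        then show ?thesis using x(3) that by blast
      next
        case False
        then show ?thesis using x(2)[of a k] that k by simp
      qed
    qed (use that x(1) Tc in auto)
    have "(T *\<^sub>v x j) \<bullet>c x i = (if i = j then complex_of_real (cond_var n T i {j. j < i}) else 0)"
    proof (cases i j rule: linorder_cases)
      case less
      then show ?thesis using orth ij by simp
    next
      case equal
      then show ?thesis using psd_form_real[OF T x(1)] x(4) ij by simp
    next
      case greater
      then have "(T *\<^sub>v x j) \<bullet>c x i = cnj 0"
        using psd_swap[OF T x(1)[OF ij(1)] x(1)[OF ij(2)]] orth[of j i] ij by simp
      then show ?thesis using greater by simp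
    qed
    then show "(C * T * mat_adjoint C) $$ (i, j) =
        mat_diag n (\<lambda>i. complex_of_real (cond_var n T i {j. j < i})) $$ (i, j)"
      unfolding gram_index[OF C Tc ij] col[OF ij(1)] col[OF ij(2)] using ij by simp
  qed (use C Tc in auto)
  ultimately show ?thesis by blast
qed

lemma perm_mat_unitary:
  assumes "perm_mat n P"
  shows "P \<in> carrier_mat n n" "P * mat_adjoint P = 1\<^sub>m n" "mat_adjoint P * P = 1\<^sub>m n"
proof -
  show P: "P \<in> carrier_mat n n" using assms by (simp add: perm_mat_def)
  note perm = assms[unfolded perm_mat_def, THEN conjunct2]
  have val: "P $$ (i, j) = 0 \<or> P $$ (i, j) = 1" if "i < n" "j < n" for i j
    using perm[THEN conjunct1] that by blast
  have row: "\<exists>!j. j < n \<and> P $$ (i, j) = 1" if "i < n" for i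
    using perm[THEN conjunct2, THEN conjunct1, rule_format, OF that] .
  have col: "\<exists>!i. i < n \<and> P $$ (i, j) = 1" if "j < n" for j
    using perm[THEN conjunct2, THEN conjunct2, rule_format, OF that] .
  show PP: "P * mat_adjoint P = 1\<^sub>m n"
  proof (rule eq_matI)
    fix i j assume "i < dim_row (1\<^sub>m n :: complex mat)" "j < dim_col (1\<^sub>m n :: complex mat)"
    then have ij: "i < n" "j < n" by auto
    obtain k where k: "k < n" "P $$ (i, k) = 1" "\<And>l. l < n \<Longrightarrow> P $$ (i, l) = 1 \<Longrightarrow> l = k"
      using row[OF ij(1)] by blast
    have "(P * mat_adjoint P) $$ (i, j) = (\<Sum>l = 0..<n. P $$ (i, l) * cnj (P $$ (j, l)))"
      using P ij by (simp add: scalar_prod_def)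
    also have "\<dots> = (\<Sum>l = 0..<n. if l = k then cnj (P $$ (j, k)) else 0)"
    proof (intro sum.cong refl)
      fix l assume "l \<in> {0..<n}"
      then have l: "l < n" by simp
      show "P $$ (i, l) * cnj (P $$ (j, l)) = (if l = k then cnj (P $$ (j, k)) else 0)"
      proof (cases "l = k")
        case False
        then have "P $$ (i, l) = 0" using val[OF ij(1) l] k(3)[OF l] by blast
        then show ?thesis using False by simp
      qed (use k(1,2) in simp)
    qed
    also have "\<dots> = cnj (P $$ (j, k))" using k(1) by simp
    also have "\<dots> = (if i = j then 1 else 0)"
    proof (cases "i = j")
      case False
      then have "P $$ (j, k) \<noteq> 1" using k(1,2) ij col[OF k(1)] by blast
      then show ?thesis using val[OF ij(2) k(1)] False by simp
    qed (use k(1,2) in simp)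
    finally show "(P * mat_adjoint P) $$ (i, j) = 1\<^sub>m n $$ (i, j)" using ij by simp
  qed (use P in auto)
  then show "mat_adjoint P * P = 1\<^sub>m n"
    by (rule mat_mult_left_right_inverse[OF P adjoint_carrier[OF P]])
qed

section \<open>Inverse Cholesky approximations of a fixed target\<close>

locale cholesky_target =
  fixes n :: nat and A P :: "complex mat" and S :: "nat \<Rightarrow> nat set"
  assumes A: "psd_mat n A" and P: "perm_mat n P" and S: "sparsity_pattern n S"
begin

definition T :: "complex mat" where "T = mat_adjoint P * A * P"

text \<open>The squared distances in the numerators and denominators of the optimal value. The numbers
  \<open>pivot i\<close> are the pivots of the Cholesky factorization of \<open>T\<close>; \<open>sparse_var i\<close> is what
  remains of them when only the positions in \<open>S i\<close> may be used for elimination.\<close>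

definition sparse_var :: "nat \<Rightarrow> real" where "sparse_var i = cond_var n T i (S i)"

definition pivot :: "nat \<Rightarrow> real" where "pivot i = cond_var n T i {j. j < i}"

definition Supp :: "nat set" where "Supp = {i. i < n \<and> pivot i > 0}"

abbreviation gram :: "complex mat \<Rightarrow> complex mat" where
  "gram C \<equiv> C * T * mat_adjoint C"

abbreviation diag_part :: "complex mat \<Rightarrow> complex mat" where
  "diag_part D \<equiv> mat_diag n (\<lambda>i. D $$ (i, i))"

lemma psd_T: "psd_mat n T"
  unfolding T_def by (rule psd_congruence[OF A perm_mat_unitary(1)[OF P]])

lemma T_carrier: "T \<in> carrier_mat n n"
  by (rule psd_carrier[OF psd_T])

lemma S_sub:
  assumes "i < n"
  shows "S i \<subseteq> {j. j < i}" "S i \<subseteq> {..<n}"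
proof -
  have "S i \<subseteq> {0..<i}" using S assms unfolding sparsity_pattern_def by blast
  then show "S i \<subseteq> {j. j < i}" "S i \<subseteq> {..<n}" using assms by auto
qed

lemma pivot_nonneg: "0 \<le> pivot i"
  by (simp add: pivot_def cond_var_nonneg)

lemma pivot_le_sparse_var:
  assumes "i < n"
  shows "pivot i \<le> sparse_var i"
proof -
  have "{j. j < i} \<subseteq> {..<n}" using assms by auto
  from cond_var_antimono[OF psd_T S_sub(1)[OF assms] this] show ?thesis
    unfolding pivot_def sparse_var_def .
qed

lemma mem_Supp: "i < n \<Longrightarrow> i \<in> Supp \<longleftrightarrow> pivot i \<noteq> 0"
  using pivot_nonneg[of i] by (auto simp: Supp_def)

lemma finite_Supp: "finite Supp"
  by (simp add: Supp_def)

lemma factors_unit_lower: "inv_chol_factors n S C D \<Longrightarrow> unit_lower n C"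
  by (auto simp: inv_chol_factors_def unit_lower_def)

lemma gram_psd:
  assumes "C \<in> carrier_mat n n" shows "psd_mat n (gram C)"
  using psd_congruence[OF psd_T adjoint_carrier[OF assms]] by simp

lemma factors_row:
  assumes "inv_chol_factors n S C D" "i < n"
  shows "col (mat_adjoint C) i \<in> carrier_vec n"
    and "j < n \<Longrightarrow> j \<notin> S i \<Longrightarrow> col (mat_adjoint C) i $ j = unit_vec n i $ j"
  using assms by (auto simp: inv_chol_factors_def intro!: carrier_vecI)

text \<open>Row \<open>i\<close> of \<open>C\<close> differs from \<open>e\<^sub>i\<close> only at the positions in \<open>S i\<close>, so the squared seminorm of
  this row is at least the squared distance.\<close>

lemma sparse_var_le_gram:
  assumes C: "inv_chol_factors n S C D" and i: "i < n"
  shows "sparse_var i \<le> Re (gram C $$ (i, i))"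
proof -
  have "C \<in> carrier_mat n n" using C by (simp add: inv_chol_factors_def)
  from gram_index[OF this T_carrier i i] show ?thesis
    using setdist_sq_le[OF psd_T S_sub(2)[OF i] unit_vec_carrier factors_row[OF C i]]
    by (simp add: sparse_var_def cond_var_def)
qed

lemma approx_congruence:
  assumes C: "inv_chol_factors n S C D"
  obtains K L where "K \<in> carrier_mat n n" "L \<in> carrier_mat n n" "K * L = 1\<^sub>m n" "L * K = 1\<^sub>m n"
    "inv_chol_mat P C D = K * diag_part D * mat_adjoint K" "L * A * mat_adjoint L = gram C"
proof -
  note p = perm_mat_unitary[OF P]
  have Cc: "C \<in> carrier_mat n n" and D: "D \<in> carrier_mat n n" "diagonal_mat D"
    using C by (auto simp: inv_chol_factors_def)
  have "C \<in> Units (ring_mat TYPE(complex) n ())"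
    using det_non_zero_imp_unit[OF Cc] det_unit_lower[OF factors_unit_lower[OF C]] by simp
  then have "mat_inverse C \<noteq> None" using mat_inverse(1)[OF Cc, of "()"] by blast
  then obtain Ci where Ci: "mat_inverse C = Some Ci" by blast
  then have inv: "C * Ci = 1\<^sub>m n" "Ci * C = 1\<^sub>m n" "Ci \<in> carrier_mat n n"
    using mat_inverse(2)[OF Cc] by auto
  have Dd: "D = diag_part D" using D by (intro eq_matI) (auto simp: diagonal_mat_def)
  have Pa: "mat_adjoint P \<in> carrier_mat n n" "mat_adjoint C \<in> carrier_mat n n"
    "mat_adjoint Ci \<in> carrier_mat n n" using p Cc inv by auto
  have Ac: "A \<in> carrier_mat n n" by (rule psd_carrier[OF A])
  note car = assoc_mult_mat[of _ n n _ n _ n] mult_carrier_mat[of _ n n _ n] p(1) Cc D(1) inv(3) Pa Ac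
  define K where "K = P * Ci"
  define L where "L = C * mat_adjoint P"
  have "K * L = P * (Ci * (C * mat_adjoint P))" unfolding K_def L_def by (simp only: car)
  also have "\<dots> = 1\<^sub>m n" using mult_inverse_cancel[OF inv(3) Cc inv(2) Pa(1)] p by simp
  finally have KL: "K * L = 1\<^sub>m n" .
  have "L * K = C * (mat_adjoint P * (P * Ci))" unfolding K_def L_def by (simp only: car)
  also have "\<dots> = 1\<^sub>m n" using mult_inverse_cancel[OF Pa(1) p(1) p(3) inv(3)] inv by simp
  finally have LK: "L * K = 1\<^sub>m n" .
  have "inv_chol_mat P C D = K * D * mat_adjoint K"
    unfolding inv_chol_mat_def Let_def Ci option.sel K_def adjoint_mult[OF p(1) inv(3)]
    by (simp only: car)
  also have "\<dots> = K * diag_part D * mat_adjoint K"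
    by (rule arg_cong[OF Dd, of "\<lambda>X. K * X * mat_adjoint K"])
  finally have B: "inv_chol_mat P C D = K * diag_part D * mat_adjoint K" .
  have Kc: "K \<in> carrier_mat n n" and Lc: "L \<in> carrier_mat n n"
    by (simp_all only: K_def L_def car)
  have "L * A * mat_adjoint L = gram C"
    unfolding L_def T_def adjoint_mult[OF Cc Pa(1)] adjoint_adjoint by (simp only: car)
  from that[OF Kc Lc KL LK B this] show ?thesis .
qed

lemma range_eq_iff:
  assumes C: "inv_chol_factors n S C D"
  shows "mat_range A = mat_range (inv_chol_mat P C D) \<longleftrightarrow>
    mat_range (gram C) = mat_range (diag_part D)"
proof -
  obtain K L where KL: "K \<in> carrier_mat n n" "L \<in> carrier_mat n n" "K * L = 1\<^sub>m n" "L * K = 1\<^sub>m n"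
    "inv_chol_mat P C D = K * diag_part D * mat_adjoint K" "L * A * mat_adjoint L = gram C"
    using approx_congruence[OF C] .
  show ?thesis
    using range_congruence_eq_iff[OF KL(1-4) psd_carrier[OF A] mat_diag_dim] unfolding KL(5,6) .
qed

text \<open>If \<open>C\<^sub>0\<close> diagonalizes \<open>T\<close>, then \<open>U = C C\<^sub>0\<^sup>-\<^sup>1\<close> is the change of basis, unit lower triangular
  because both factors are.\<close>

lemma gram_decomposition:
  assumes C: "unit_lower n C"
  obtains U where "unit_lower n U"
    "gram C = U * mat_diag n (\<lambda>i. complex_of_real (pivot i)) * mat_adjoint U"
proof -
  obtain C0 where C0: "unit_lower n C0"
    "C0 * T * mat_adjoint C0 = mat_diag n (\<lambda>i. complex_of_real (pivot i))"
    using cholesky_exists[OF psd_T] unfolding pivot_def by blast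
  have c: "C \<in> carrier_mat n n" "C0 \<in> carrier_mat n n"
    using C C0 by (auto simp: unit_lower_def)
  obtain X where X: "X \<in> carrier_mat n n" "X * C0 = 1\<^sub>m n" "C0 * X = 1\<^sub>m n"
    using inverse_of_det_nonzero[OF c(2)] det_unit_lower[OF C0(1)] by auto
  have "unit_lower n (C * X)"
    by (rule unit_lower_mult[OF C unit_lower_inverse[OF C0(1) X(1,3)]])
  moreover have "gram C = (C * X) * mat_diag n (\<lambda>i. complex_of_real (pivot i)) * mat_adjoint (C * X)"
  proof -
    have a: "mat_adjoint X \<in> carrier_mat n n" "mat_adjoint C \<in> carrier_mat n n" using X c by auto
    have "T = X * mat_diag n (\<lambda>i. complex_of_real (pivot i)) * mat_adjoint X"
      using congruence_inverse[OF X(1) c(2) X(2) T_carrier] C0(2) by simp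
    then have "gram C =
        C * (X * mat_diag n (\<lambda>i. complex_of_real (pivot i)) * mat_adjoint X) * mat_adjoint C"
      by simp
    also have "\<dots> = (C * X) * mat_diag n (\<lambda>i. complex_of_real (pivot i)) * mat_adjoint (C * X)"
      unfolding adjoint_mult[OF c(1) X(1)]
      by (simp only: assoc_mult_mat[of _ n n _ n _ n] mult_carrier_mat[of _ n n _ n]
          c X(1) a mat_diag_dim)
    finally show ?thesis .
  qed
  ultimately show ?thesis using that by blast
qed

lemma gram_hermitian:
  assumes "C \<in> carrier_mat n n" "i < n" "j < n"
  shows "gram C $$ (i, j) = cnj (gram C $$ (j, i))"
proof -
  have "gram C \<in> carrier_mat n n" using psd_carrier[OF gram_psd[OF assms(1)]] .
  then have "mat_adjoint (gram C) $$ (i, j) = cnj (gram C $$ (j, i))" using assms by simp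
  then show ?thesis unfolding psd_adjoint[OF gram_psd[OF assms(1)]] .
qed

text \<open>Zeros of \<open>D\<close> lie at zeros of \<open>pivot\<close> because \<open>pivot i \<le> sparse_var i \<le> gram C (i, i)\<close>.
  Conversely, if \<open>D = gram C Y = U W U\<^sup>* Y\<close>, then row \<open>i\<close> of \<open>U\<^sup>-\<^sup>1 D\<close>, whose diagonal entry
  is \<open>D (i, i)\<close>, vanishes wherever \<open>pivot i = 0\<close>.\<close>

lemma support_eq:
  assumes C: "inv_chol_factors n S C D"
    and rng: "mat_range (gram C) = mat_range (diag_part D)" and i: "i < n"
  shows "D $$ (i, i) = 0 \<longleftrightarrow> pivot i = 0"
proof
  have Cc: "C \<in> carrier_mat n n" using C by (simp add: inv_chol_factors_def)
  have G: "gram C \<in> carrier_mat n n" using psd_carrier[OF gram_psd[OF Cc]] .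
  {
    assume "D $$ (i, i) = 0"
    then have "gram C $$ (i, i) = 0" using range_diag_iff[OF G, of "\<lambda>i. D $$ (i, i)"] rng i by blast
    then show "pivot i = 0"
      using sparse_var_le_gram[OF C i] pivot_le_sparse_var[OF i] pivot_nonneg[of i] by simp
  next
    assume w0: "pivot i = 0"
    let ?W = "mat_diag n (\<lambda>i. complex_of_real (pivot i))"
    obtain U where U: "unit_lower n U" "gram C = U * ?W * mat_adjoint U"
      by (rule gram_decomposition[OF factors_unit_lower[OF C]])
    have Uc: "U \<in> carrier_mat n n" "mat_adjoint U \<in> carrier_mat n n"
      using U(1) by (auto simp: unit_lower_def)
    obtain X where X: "X \<in> carrier_mat n n" "X * U = 1\<^sub>m n" "U * X = 1\<^sub>m n"
      using inverse_of_det_nonzero[OF Uc(1)] det_unit_lower[OF U(1)] by auto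
    have Xl: "X $$ (i, i) = 1"
      using unit_lower_inverse[OF U(1) X(1,3)] i by (simp add: unit_lower_def)
    obtain Y where Y: "Y \<in> carrier_mat n n" "diag_part D = gram C * Y"
      using range_subset_iff[OF mat_diag_dim G] rng by blast
    have Z: "mat_adjoint U * Y \<in> carrier_mat n n" using Uc Y by (intro mult_carrier_mat)
    have WZ: "?W * (mat_adjoint U * Y) \<in> carrier_mat n n"
      using Z by (intro mult_carrier_mat[OF mat_diag_dim])
    have "X * diag_part D = X * (U * (?W * (mat_adjoint U * Y)))"
      unfolding Y(2) U(2)
      by (simp only: assoc_mult_mat[of _ n n _ n _ n] mult_carrier_mat[of _ n n _ n]
          Uc X(1) Y(1) mat_diag_dim)
    also have "\<dots> = ?W * (mat_adjoint U * Y)" by (rule mult_inverse_cancel[OF X(1) Uc(1) X(2) WZ])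
    finally have "(X * diag_part D) $$ (i, i) = (?W * (mat_adjoint U * Y)) $$ (i, i)"
      by (rule arg_cong)
    then show "D $$ (i, i) = 0"
      unfolding mat_diag_mult_right[OF X(1)] mat_diag_mult_left[OF Z] using i w0 Xl by simp
  }
qed

lemma factors_diag_real:
  assumes "inv_chol_factors n S C D" "i < n"
  shows "0 \<le> D $$ (i, i)" "D $$ (i, i) = complex_of_real (Re (D $$ (i, i)))"
proof -
  show "0 \<le> D $$ (i, i)" using assms by (simp add: inv_chol_factors_def)
  then show "D $$ (i, i) = complex_of_real (Re (D $$ (i, i)))"
    by (simp add: less_eq_complex_def complex_eq_iff)
qed

lemma rank_target: "vec_space.rank n A = card Supp"
proof -
  note p = perm_mat_unitary[OF P]
  let ?W = "mat_diag n (\<lambda>i. complex_of_real (pivot i))"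
  have one: "unit_lower n (1\<^sub>m n)" by (auto simp: unit_lower_def)
  obtain U where U: "unit_lower n U" "gram (1\<^sub>m n) = U * ?W * mat_adjoint U"
    by (rule gram_decomposition[OF one])
  have Uc: "U \<in> carrier_mat n n" "mat_adjoint U \<in> carrier_mat n n" "mat_adjoint P \<in> carrier_mat n n"
    using U(1) p(1) by (auto simp: unit_lower_def)
  have "mat_adjoint (1\<^sub>m n :: complex mat) = 1\<^sub>m n" by (intro eq_matI) auto
  then have T_eq: "T = U * ?W * mat_adjoint U" using U(2) T_carrier by simp
  have "A = P * T * mat_adjoint P"
    using congruence_inverse[OF p(1) Uc(3) p(2) psd_carrier[OF A]]
    unfolding T_def adjoint_adjoint by (rule sym)
  also have "\<dots> = P * (U * ?W * mat_adjoint U) * mat_adjoint P"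
    by (rule arg_cong[OF T_eq, of "\<lambda>X. P * X * mat_adjoint P"])
  also have "\<dots> = (P * U) * ?W * (mat_adjoint U * mat_adjoint P)"
    by (simp only: assoc_mult_mat[of _ n n _ n _ n] mult_carrier_mat[of _ n n _ n] Uc p(1) mat_diag_dim)
  finally have "vec_space.rank n A =
      vec_space.rank n ((P * U) * ?W * (mat_adjoint U * mat_adjoint P))" by (rule arg_cong)
  also have "\<dots> = card {i\<in>{..<n}. complex_of_real (pivot i) \<noteq> 0}"
    using det_nonzero_of_inverse[OF p(1) Uc(3) p(2)] p(1) Uc
    by (intro rank_diag_equivalence)
      (auto simp: det_mult[of _ n] det_unit_lower[OF U(1)] det_adjoint_unit_lower[OF U(1)]
        intro!: mult_carrier_mat)
  also have "{i\<in>{..<n}. complex_of_real (pivot i) \<noteq> 0} = Supp"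
    using mem_Supp by (auto simp: Supp_def)
  finally show ?thesis .
qed

text \<open>Both ingredients come from \<open>H = gram C D\<^sup>+\<close>. Its trace can be read off the diagonal. For its
  volume, adding the projection \<open>J\<close> onto the complement of the support gives a determinant
  that splits as \<open>det (gram C + J) det (D\<^sup>+ + J)\<close>, and the first factor is the product of the
  positive pivots.\<close>

lemma kaporin_value:
  assumes C: "inv_chol_factors n S C D" and rng: "mat_range A = mat_range (inv_chol_mat P C D)"
  shows "kaporin A (inv_chol_mat P C D) =
    ereal (((\<Sum>i\<in>Supp. Re (gram C $$ (i, i)) / Re (D $$ (i, i))) / card Supp) ^ card Supp /
      (\<Prod>i\<in>Supp. pivot i / Re (D $$ (i, i))))"
proof -
  obtain K L where KL: "K \<in> carrier_mat n n" "L \<in> carrier_mat n n" "K * L = 1\<^sub>m n" "L * K = 1\<^sub>m n"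
    and B: "inv_chol_mat P C D = K * diag_part D * mat_adjoint K"
    and LA: "L * A * mat_adjoint L = gram C"
    by (rule approx_congruence[OF C])
  define d where "d = (\<lambda>i. D $$ (i, i))"
  define M where "M = gram C"
  define H where "H = M * mat_diag n (\<lambda>i. inverse (d i))"
  have Cc: "C \<in> carrier_mat n n" using C by (simp add: inv_chol_factors_def)
  have M: "psd_mat n M" unfolding M_def by (rule gram_psd[OF Cc])
  have Mc: "M \<in> carrier_mat n n" using psd_carrier[OF M] .
  have Hc: "H \<in> carrier_mat n n" unfolding H_def by (rule mult_carrier_mat[OF Mc mat_diag_dim])
  have Hij: "H $$ (i, j) = M $$ (i, j) * inverse (d j)" if "i < n" "j < n" for i j
    using that unfolding H_def mat_diag_mult_right[OF Mc] by simp
  have d: "0 \<le> d i" "d i = complex_of_real (Re (d i))" if "i < n" for i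
    using factors_diag_real[OF C that] by (simp_all add: d_def)
  have rngM: "mat_range M = mat_range (mat_diag n d)"
    using rng range_eq_iff[OF C] by (simp add: M_def d_def)
  have supp: "d i = 0 \<longleftrightarrow> pivot i = 0" if "i < n" for i
    using support_eq[OF C] rngM that by (simp add: M_def d_def)
  have row0: "M $$ (i, j) = 0" if "i < n" "j < n" "d i = 0" for i j
    using range_diag_iff[OF Mc, of d] rngM that by blast
  have col0: "M $$ (i, j) = 0" if "i < n" "j < n" "d j = 0" for i j
    using row0[of j i] that gram_hermitian[OF Cc that(1,2)] by (simp add: M_def)
  have kap: "kaporin A (inv_chol_mat P C D) =
      ereal ((Re (mat_trace H) / card Supp) ^ card Supp / mat_vol H)"
    using kaporin_congruence[OF A KL d(1)] rng unfolding B LA rank_target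
    by (simp add: H_def M_def d_def)
  have tr: "Re (mat_trace H) = (\<Sum>i\<in>Supp. Re (M $$ (i, i)) / Re (d i))"
  proof -
    have "Re (mat_trace H) = (\<Sum>i = 0..<n. Re (H $$ (i, i)))" using Hc by (simp add: mat_trace_def)
    also have "\<dots> = (\<Sum>i = 0..<n. Re (M $$ (i, i)) / Re (d i))"
    proof (intro sum.cong refl)
      fix i assume "i \<in> {0..<n}"
      then have i: "i < n" by simp
      have "H $$ (i, i) = M $$ (i, i) * complex_of_real (inverse (Re (d i)))"
        unfolding Hij[OF i i] by (subst d(2)[OF i]) simp
      moreover have "Re (z * complex_of_real c) = Re z * c" for z c by simp
      ultimately show "Re (H $$ (i, i)) = Re (M $$ (i, i)) / Re (d i)"
        by (simp only: divide_inverse)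
    qed
    also have "\<dots> = (\<Sum>i\<in>Supp. Re (M $$ (i, i)) / Re (d i))"
    proof (intro sum.mono_neutral_right ballI)
      fix i assume "i \<in> {0..<n} - Supp"
      then have "d i = 0" using supp[of i] mem_Supp[of i] by auto
      then show "Re (M $$ (i, i)) / Re (d i) = 0" by simp
    qed (auto simp: Supp_def)
    finally show ?thesis .
  qed
  have J: "ker_proj n d = ker_proj n (\<lambda>i. complex_of_real (pivot i))"
    using supp by (intro diag_cong) simp
  obtain U where U: "unit_lower n U"
    "M = U * mat_diag n (\<lambda>i. complex_of_real (pivot i)) * mat_adjoint U"
    unfolding M_def by (rule gram_decomposition[OF factors_unit_lower[OF C]])
  have detM: "det (M + ker_proj n d) = (\<Prod>i<n. if pivot i = 0 then 1 else complex_of_real (pivot i))"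
    unfolding J U(2) using det_plus_ker_proj[OF U(1), of "\<lambda>i. complex_of_real (pivot i)"] by simp
  have HF: "H + ker_proj n d = (M + ker_proj n d) * mat_diag n (\<lambda>i. if d i = 0 then 1 else inverse (d i))"
    unfolding mat_diag_mult_right[OF add_carrier_mat[OF mat_diag_dim], of M] using Hc Mc Hij col0
    by (intro eq_matI) auto
  have "det (H + ker_proj n d) = det (M + ker_proj n d) * (\<Prod>i<n. if d i = 0 then 1 else inverse (d i))"
    unfolding HF det_mult[OF add_carrier_mat[OF mat_diag_dim] mat_diag_dim] det_diag ..
  also have "\<dots> = (\<Prod>i<n. if pivot i = 0 then 1 else complex_of_real (pivot i / Re (d i)))"
    unfolding detM prod.distrib[symmetric]
  proof (intro prod.cong refl)
    fix i assume "i \<in> {..<n}"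
    then have i: "i < n" by simp
    show "(if pivot i = 0 then 1 else complex_of_real (pivot i)) *
        (if d i = 0 then 1 else inverse (d i)) =
        (if pivot i = 0 then 1 else complex_of_real (pivot i / Re (d i)))"
      using supp[OF i] d(2)[OF i] by (simp add: divide_inverse)
  qed
  also have "\<dots> = (\<Prod>i\<in>Supp. complex_of_real (pivot i / Re (d i)))"
    using mem_Supp by (intro prod.mono_neutral_cong_right) (auto simp: Supp_def)
  finally have det: "det (H + ker_proj n d) = complex_of_real (\<Prod>i\<in>Supp. pivot i / Re (d i))" by simp
  have pos: "0 < Re (d i)" "0 < pivot i" if "i \<in> Supp" for i
  proof -
    have i: "i < n" "pivot i > 0" using that by (auto simp: Supp_def)
    then have "d i \<noteq> 0" using supp by auto
    then have "Re (d i) \<noteq> 0" using d(2)[OF i(1)] by (metis of_real_0)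
    moreover have "0 \<le> Re (d i)" using d(1)[OF i(1)] by (simp add: less_eq_complex_def)
    ultimately show "0 < Re (d i)" by simp
    show "0 < pivot i" by (fact i(2))
  qed
  have "0 < (\<Prod>i\<in>Supp. pivot i / Re (d i))"
    by (intro prod_pos divide_pos_pos pos)
  then have "det (H + ker_proj n d) \<noteq> 0" unfolding det by (simp del: of_real_prod)
  then have "complex_of_real (mat_vol H) = det (H + ker_proj n d)"
  proof (rule vol_eq_det[OF Hc, rotated 2])
    show "H $$ (i, j) = 0" if "i < n" "j < n" "d j = 0" for i j
      using Hij[OF that(1,2)] that(3) by simp
    show "0 \<le> a" if "eigenvalue H a" for a
      using eigenvalue_psd_times_diag_nonneg[OF M, of d a] d(1) row0 that unfolding H_def by blast
  qed
  then have "mat_vol H = (\<Prod>i\<in>Supp. pivot i / Re (d i))" unfolding det of_real_eq_iff .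
  then show ?thesis unfolding kap tr by (simp add: M_def d_def)
qed

definition vecchia_factors :: "complex mat \<Rightarrow> complex mat \<Rightarrow> bool" where
  "vecchia_factors C D \<longleftrightarrow> inv_chol_factors n S C D \<and>
     (\<forall>i<n. (\<forall>j \<in> S i. (\<Sum>k \<in> S i. C $$ (i, k) * T $$ (k, j)) + T $$ (i, j) = 0) \<and>
            (\<Sum>k \<in> S i. C $$ (i, k) * T $$ (k, i)) + T $$ (i, i) = D $$ (i, i))"

text \<open>The block equation states that \<open>T x\<close>, with \<open>x\<close> the conjugate of row \<open>i\<close> of \<open>C\<close>, vanishes on
  \<open>S i\<close> and equals \<open>D (i, i)\<close> at \<open>i\<close>. The first part makes \<open>x\<close> the residual of the orthogonal
  projection of \<open>e\<^sub>i\<close>, the second identifies \<open>D (i, i)\<close> with its squared seminorm.\<close>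

lemma vecchia_row:
  assumes V: "vecchia_factors C D" and i: "i < n"
  shows "gram C $$ (i, i) = complex_of_real (sparse_var i)" "D $$ (i, i) = complex_of_real (sparse_var i)"
proof -
  have C: "inv_chol_factors n S C D"
    and off: "\<forall>j \<in> S i. (\<Sum>k \<in> S i. C $$ (i, k) * T $$ (k, j)) + T $$ (i, j) = 0"
    and diag: "(\<Sum>k \<in> S i. C $$ (i, k) * T $$ (k, i)) + T $$ (i, i) = D $$ (i, i)"
    using V i unfolding vecchia_factors_def by blast+
  define x where "x = col (mat_adjoint C) i"
  have Cc: "C \<in> carrier_mat n n" using C by (simp add: inv_chol_factors_def)
  have x: "x \<in> carrier_vec n" and xi: "\<And>j. j < n \<Longrightarrow> j \<notin> S i \<Longrightarrow> x $ j = unit_vec n i $ j"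
    using factors_row[OF C i] by (simp_all add: x_def)
  have xj: "x $ j = cnj (C $$ (i, j))" if "j < n" for j
    using that i Cc by (simp add: x_def)
  have Tx: "T *\<^sub>v x \<in> carrier_vec n" using T_carrier x by simp
  have iS: "i \<notin> S i" using S_sub(1)[OF i] by auto
  have fin: "finite (S i)" using S_sub(2)[OF i] finite_subset by blast
  have Th: "T $$ (a, b) = cnj (T $$ (b, a))" if "a < n" "b < n" for a b
    using that T_carrier psd_adjoint[OF psd_T] adjoint_index[of a T b] by simp
  have Txj: "(T *\<^sub>v x) $ j = cnj ((\<Sum>k \<in> S i. C $$ (i, k) * T $$ (k, j)) + T $$ (i, j))"
    if j: "j < n" for j
  proof -
    have "(T *\<^sub>v x) $ j = (\<Sum>k = 0..<n. T $$ (j, k) * x $ k)"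
      using j T_carrier x by (simp add: scalar_prod_def)
    also have "\<dots> = (\<Sum>k = 0..<n. cnj (C $$ (i, k) * T $$ (k, j)))"
    proof (intro sum.cong refl)
      fix k assume "k \<in> {0..<n}"
      then show "T $$ (j, k) * x $ k = cnj (C $$ (i, k) * T $$ (k, j))"
        using Th[OF j, of k] xj[of k] by simp
    qed
    also have "\<dots> = (\<Sum>k \<in> insert i (S i). cnj (C $$ (i, k) * T $$ (k, j)))"
      using S_sub(2)[OF i] i C
      by (intro sum_supported) (auto simp: inv_chol_factors_def)
    also have "\<dots> = cnj ((\<Sum>k \<in> S i. C $$ (i, k) * T $$ (k, j)) + T $$ (i, j))"
      using fin iS i C by (simp add: inv_chol_factors_def)
    finally show ?thesis .
  qed
  have orth: "(T *\<^sub>v x) $ j = 0" if "j \<in> S i" for j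
    using Txj[of j] off that S_sub(2)[OF i] by auto
  have "gram C $$ (i, i) = (T *\<^sub>v x) \<bullet>c x"
    using gram_index[OF Cc T_carrier i i] by (simp add: x_def)
  moreover have "sparse_var i = Re ((T *\<^sub>v x) \<bullet>c x)"
    using setdist_sq_eq[OF psd_T S_sub(2)[OF i] unit_vec_carrier x xi orth]
    by (simp add: sparse_var_def cond_var_def)
  ultimately show g: "gram C $$ (i, i) = complex_of_real (sparse_var i)"
    using psd_form_real[OF psd_T x] by simp
  have "(T *\<^sub>v x) \<bullet>c x = (\<Sum>j = 0..<n. if j = i then (T *\<^sub>v x) $ i else 0)"
  proof (subst cscalar_eq_sum[OF Tx x], intro sum.cong refl)
    fix j assume "j \<in> {0..<n}"
    then have j: "j < n" by simp
    show "(T *\<^sub>v x) $ j * cnj (x $ j) = (if j = i then (T *\<^sub>v x) $ i else 0)"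
    proof (cases "j \<in> S i")
      case True
      then show ?thesis using orth iS by auto
    next
      case False
      then show ?thesis using xi[OF j] j i by simp
    qed
  qed
  also have "\<dots> = cnj (D $$ (i, i))" using i Txj[OF i] diag by simp
  also have "\<dots> = D $$ (i, i)" by (subst (1 2) factors_diag_real(2)[OF C i]) simp
  finally show "D $$ (i, i) = complex_of_real (sparse_var i)"
    using g \<open>gram C $$ (i, i) = (T *\<^sub>v x) \<bullet>c x\<close> by simp
qed

text \<open>A zero diagonal entry of the positive-semidefinite Gram matrix forces a zero row, so the
  range of the Gram matrix lies in the coordinate subspace over the support of \<open>pivot\<close>. It
  fills this subspace: the Gram matrix becomes invertible when the complementary coordinate
  projection is added.\<close>

lemma range_eqI:
  assumes C: "inv_chol_factors n S C D"
    and g0: "\<And>i. i < n \<Longrightarrow> pivot i = 0 \<Longrightarrow> gram C $$ (i, i) = 0"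
    and supp: "\<And>i. i < n \<Longrightarrow> D $$ (i, i) = 0 \<longleftrightarrow> pivot i = 0"
  shows "mat_range (gram C) = mat_range (diag_part D)"
proof (rule antisym)
  have Cc: "C \<in> carrier_mat n n" using C by (simp add: inv_chol_factors_def)
  define M where "M = gram C"
  have M: "M \<in> carrier_mat n n" unfolding M_def using psd_carrier[OF gram_psd[OF Cc]] .
  have row0: "M $$ (i, j) = 0" if i: "i < n" and j: "j < n" and w0: "pivot i = 0" for i j
  proof -
    let ?x = "\<lambda>i. col (mat_adjoint C) i"
    have x: "?x i \<in> carrier_vec n" "?x j \<in> carrier_vec n"
      using factors_row(1)[OF C] i j by auto
    have "T *\<^sub>v ?x i = 0\<^sub>v n"
      using psd_null_vector[OF psd_T x(1)] g0[OF i w0] gram_index[OF Cc T_carrier i i] by simp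
    then have "gram C $$ (j, i) = 0" using gram_index[OF Cc T_carrier j i] x by simp
    then show ?thesis unfolding M_def gram_hermitian[OF Cc i j] by simp
  qed
  then show "mat_range (gram C) \<subseteq> mat_range (diag_part D)"
    using range_diag_iff[OF M, of "\<lambda>i. D $$ (i, i)"] supp by (simp add: M_def)
  let ?pivot = "\<lambda>i. complex_of_real (pivot i)"
  let ?J = "ker_proj n ?pivot"
  obtain U where U: "unit_lower n U" "M = U * mat_diag n ?pivot * mat_adjoint U"
    unfolding M_def by (rule gram_decomposition[OF factors_unit_lower[OF C]])
  have MJ: "M + ?J \<in> carrier_mat n n" by (rule add_carrier_mat[OF mat_diag_dim])
  have "det (M + ?J) \<noteq> 0"
    unfolding U(2) det_plus_ker_proj[OF U(1)] by simp
  then obtain N where N: "N \<in> carrier_mat n n" "(M + ?J) * N = 1\<^sub>m n"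
    using inverse_of_det_nonzero[OF MJ] by blast
  have MN: "M * N \<in> carrier_mat n n" "?J * N \<in> carrier_mat n n"
    using M N by (auto intro: mult_carrier_mat)
  have split: "M * N + ?J * N = 1\<^sub>m n"
    using add_mult_distrib_mat[OF M mat_diag_dim N(1)] N(2) by simp
  have E: "M * N = supp_proj n ?pivot"
  proof (rule eq_matI)
    fix i j assume "i < dim_row (supp_proj n ?pivot)" "j < dim_col (supp_proj n ?pivot)"
    then have ij: "i < n" "j < n" by auto
    show "(M * N) $$ (i, j) = supp_proj n ?pivot $$ (i, j)"
    proof (cases "pivot i = 0")
      case True
      have "(M * N) $$ (i, j) = (\<Sum>k = 0..<n. M $$ (i, k) * N $$ (k, j))"
        using M N ij by (simp add: scalar_prod_def)
      also have "\<dots> = 0" using row0[OF ij(1) _ True] by (intro sum.neutral) auto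
      finally show ?thesis using True ij by (cases "i = j") auto
    next
      case False
      have "(M * N) $$ (i, j) + (?J * N) $$ (i, j) = 1\<^sub>m n $$ (i, j)"
        using arg_cong[OF split, of "\<lambda>X. X $$ (i, j)"] index_add_mat(1)[of i "?J * N" j "M * N"] MN ij
        by (simp del: index_mult_mat)
      moreover have "(?J * N) $$ (i, j) = 0"
        unfolding mat_diag_mult_left[OF N(1)] using ij False by simp
      ultimately show ?thesis using ij False by (cases "i = j") auto
    qed
  qed (use M N in auto)
  have "supp_proj n ?pivot * diag_part D = diag_part D"
    unfolding mat_diag_diag using supp by (intro diag_cong) auto
  then have "diag_part D = M * (N * diag_part D)"
    using assoc_mult_mat[OF M N(1) mat_diag_dim] E by simp
  moreover have "N * diag_part D \<in> carrier_mat n n" by (rule mult_carrier_mat[OF N(1) mat_diag_dim])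
  ultimately show "mat_range (diag_part D) \<subseteq> mat_range (gram C)"
    using range_subset_iff[OF mat_diag_dim M] unfolding M_def by blast
qed

text \<open>By the inequality of means, the power of the mean of \<open>g i / d i\<close> dominates the product, in
  which \<open>d\<close> cancels against the volume; what remains is a product of \<open>g i / pivot i\<close>.\<close>

lemma kaporin_lower_bound:
  assumes C: "inv_chol_factors n S C D" and rng: "mat_range A = mat_range (inv_chol_mat P C D)"
  shows "ereal (\<Prod>i\<in>Supp. sparse_var i / pivot i) \<le> kaporin A (inv_chol_mat P C D)"
proof -
  define g where "g i = Re (gram C $$ (i, i))" for i
  define d where "d i = Re (D $$ (i, i))" for i
  have rngM: "mat_range (gram C) = mat_range (diag_part D)" using rng range_eq_iff[OF C] by simp
  have pos: "0 < pivot i" "0 < d i" "pivot i \<le> sparse_var i" "sparse_var i \<le> g i" if "i \<in> Supp" for i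
  proof -
    have i: "i < n" "pivot i > 0" using that by (auto simp: Supp_def)
    show "0 < pivot i" "pivot i \<le> sparse_var i" "sparse_var i \<le> g i"
      using i pivot_le_sparse_var sparse_var_le_gram[OF C] by (auto simp: g_def)
    have "D $$ (i, i) \<noteq> 0" using support_eq[OF C rngM i(1)] i by simp
    then have "d i \<noteq> 0" using factors_diag_real(2)[OF C i(1)] unfolding d_def by (metis of_real_0)
    moreover have "0 \<le> d i"
      using factors_diag_real(1)[OF C i(1)] by (simp add: d_def less_eq_complex_def)
    ultimately show "0 < d i" by simp
  qed
  have "(\<Prod>i\<in>Supp. sparse_var i / pivot i) \<le> (\<Prod>i\<in>Supp. g i / pivot i)"
  proof (intro prod_mono conjI)
    fix i assume i: "i \<in> Supp"
    show "sparse_var i / pivot i \<le> g i / pivot i" using pos[OF i] by (intro divide_right_mono) auto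
    show "0 \<le> sparse_var i / pivot i" using pos[OF i] by (intro divide_nonneg_pos) auto
  qed
  also have "\<dots> = (\<Prod>i\<in>Supp. g i / d i) / (\<Prod>i\<in>Supp. pivot i / d i)"
    unfolding prod_dividef[symmetric]
  proof (intro prod.cong refl)
    fix i assume "i \<in> Supp"
    then show "g i / pivot i = g i / d i / (pivot i / d i)" using pos(2)[of i] by simp
  qed
  also have "\<dots> \<le> ((\<Sum>i\<in>Supp. g i / d i) / card Supp) ^ card Supp / (\<Prod>i\<in>Supp. pivot i / d i)"
  proof (rule divide_right_mono)
    show "(\<Prod>i\<in>Supp. g i / d i) \<le> ((\<Sum>i\<in>Supp. g i / d i) / card Supp) ^ card Supp"
    proof (rule prod_le_mean_power[OF finite_Supp])
      fix i assume "i \<in> Supp"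
      from pos[OF this] show "0 \<le> g i / d i" by (intro divide_nonneg_pos) auto
    qed
    show "0 \<le> (\<Prod>i\<in>Supp. pivot i / d i)"
      by (intro prod_nonneg less_imp_le divide_pos_pos ballI pos)
  qed
  finally show ?thesis unfolding kaporin_value[OF C rng] g_def d_def by simp
qed

lemma vecchia_kaporin:
  assumes V: "vecchia_factors C D" and rng: "mat_range A = mat_range (inv_chol_mat P C D)"
  shows "kaporin A (inv_chol_mat P C D) = ereal (\<Prod>i\<in>Supp. sparse_var i / pivot i)"
proof -
  have C: "inv_chol_factors n S C D" using V by (simp add: vecchia_factors_def)
  have r: "Re (gram C $$ (i, i)) = sparse_var i" "Re (D $$ (i, i)) = sparse_var i" "sparse_var i \<noteq> 0"
    if "i \<in> Supp" for i
    using that vecchia_row[OF V, of i] pivot_le_sparse_var[of i] by (auto simp: Supp_def)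
  have "(\<Sum>i\<in>Supp. Re (gram C $$ (i, i)) / Re (D $$ (i, i))) = (\<Sum>i\<in>Supp. 1)"
    using r by (intro sum.cong) auto
  then have "((\<Sum>i\<in>Supp. Re (gram C $$ (i, i)) / Re (D $$ (i, i))) / card Supp) ^ card Supp = 1"
    by (cases "card Supp = 0") auto
  moreover have "(\<Prod>i\<in>Supp. sparse_var i / pivot i) = inverse (\<Prod>i\<in>Supp. pivot i / Re (D $$ (i, i)))"
    unfolding prod_inversef[symmetric] using r by (intro prod.cong) auto
  ultimately show ?thesis unfolding kaporin_value[OF C rng] by (simp add: divide_inverse)
qed

text \<open>A competitor with the right range has zeros on the diagonal of its Gram matrix wherever the
  pivot is zero, and these diagonal entries dominate \<open>sparse_var\<close>. Hence \<open>sparse_var\<close>, the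
  common diagonal of the Vecchia factor and of its Gram matrix, has the same zeros as
  \<open>pivot\<close>.\<close>

lemma vecchia_range:
  assumes V: "vecchia_factors C D" and C': "inv_chol_factors n S C' D'"
    and rng: "mat_range A = mat_range (inv_chol_mat P C' D')"
  shows "mat_range A = mat_range (inv_chol_mat P C D)"
proof -
  have C: "inv_chol_factors n S C D" using V by (simp add: vecchia_factors_def)
  have C'c: "C' \<in> carrier_mat n n" using C' by (simp add: inv_chol_factors_def)
  have rngM: "mat_range (gram C') = mat_range (diag_part D')" using rng range_eq_iff[OF C'] by simp
  have v0: "sparse_var i = 0" if i: "i < n" and w0: "pivot i = 0" for i
  proof -
    have "D' $$ (i, i) = 0" using support_eq[OF C' rngM i] w0 by simp
    then have "gram C' $$ (i, i) = 0"
      using range_diag_iff[OF psd_carrier[OF gram_psd[OF C'c]], of "\<lambda>i. D' $$ (i, i)"] rngM i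
      by blast
    then show ?thesis using sparse_var_le_gram[OF C' i] pivot_le_sparse_var[OF i] w0 by simp
  qed
  have "sparse_var i = 0 \<longleftrightarrow> pivot i = 0" if "i < n" for i
    using v0[OF that] pivot_le_sparse_var[OF that] pivot_nonneg[of i] by auto
  then have "mat_range (gram C) = mat_range (diag_part D)"
    using vecchia_row[OF V] by (intro range_eqI[OF C]) auto
  then show ?thesis using range_eq_iff[OF C] by simp
qed

end

theorem theorem3p1:
  fixes n :: nat and A P Ahat At :: "complex mat" and S :: "nat \<Rightarrow> nat set"
  assumes "psd_mat n A"
    and "perm_mat n P"
    and "sparsity_pattern n S"
    and "vecchia_approx n A P S Ahat"
  defines "At \<equiv> mat_adjoint P * A * P"
  shows "(\<forall>B. inverse_cholesky_approx n P S B \<longrightarrow> kaporin A Ahat \<le> kaporin A B) \<and>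
    (mat_range Ahat = mat_range A \<longrightarrow>
      kaporin A Ahat = ereal (\<Prod>i \<in> {i. i < n \<and>
            mat_setdist At (unit_vec n i) (cspan n (unit_vec n ` {j. j < i})) > 0}.
          (mat_setdist At (unit_vec n i) (cspan n (unit_vec n ` S i)))\<^sup>2 /
          (mat_setdist At (unit_vec n i) (cspan n (unit_vec n ` {j. j < i})))\<^sup>2))"
proof -
  interpret cholesky_target n A P S by unfold_locales (fact assms)+
  have At: "At = T" by (simp add: At_def T_def)
  obtain C D where V: "vecchia_factors C D" and Ahat: "Ahat = inv_chol_mat P C D"
    using assms(4) unfolding vecchia_approx_def vecchia_factors_def Let_def T_def by blast
  note kap = vecchia_kaporin[OF V]
  have optimal: "kaporin A Ahat \<le> kaporin A B" if B: "inverse_cholesky_approx n P S B" for B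
  proof (cases "mat_range A = mat_range B")
    case True
    obtain C' D' where C': "inv_chol_factors n S C' D'" "B = inv_chol_mat P C' D'"
      using B unfolding inverse_cholesky_approx_def by blast
    have rngB: "mat_range A = mat_range (inv_chol_mat P C' D')" using True C'(2) by simp
    have "kaporin A Ahat = ereal (\<Prod>i\<in>Supp. sparse_var i / pivot i)"
      unfolding Ahat by (rule kap[OF vecchia_range[OF V C'(1) rngB]])
    then show ?thesis unfolding C'(2) using kaporin_lower_bound[OF C'(1) rngB] by simp
  next
    case False
    then show ?thesis by (simp add: kaporin_def)
  qed
  have Supp_eq: "Supp = {i. i < n \<and>
      mat_setdist At (unit_vec n i) (cspan n (unit_vec n ` {j. j < i})) > 0}"
  proof -
    have "pivot i > 0 \<longleftrightarrow> mat_setdist T (unit_vec n i) (cspan n (unit_vec n ` {j. j < i})) > 0"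
      if "i < n" for i
    proof -
      have sub: "{j. j < i} \<subseteq> {..<n}" using that by auto
      have "0 \<le> mat_setdist T (unit_vec n i) (cspan n (unit_vec n ` {j. j < i}))"
        by (rule mat_setdist_bounds(1)[OF psd_T, of "0\<^sub>v n"]) (auto simp: cspan_unit_vecs[OF sub])
      then show ?thesis by (simp add: pivot_def cond_var_def less_le)
    qed
    then show ?thesis unfolding Supp_def At by blast
  qed
  have "(\<Prod>i\<in>Supp. sparse_var i / pivot i) = (\<Prod>i \<in> {i. i < n \<and>
            mat_setdist At (unit_vec n i) (cspan n (unit_vec n ` {j. j < i})) > 0}.
          (mat_setdist At (unit_vec n i) (cspan n (unit_vec n ` S i)))\<^sup>2 /
          (mat_setdist At (unit_vec n i) (cspan n (unit_vec n ` {j. j < i})))\<^sup>2)"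
    by (simp only: Supp_eq sparse_var_def pivot_def cond_var_def At)
  then have "kaporin A Ahat = ereal (\<Prod>i \<in> {i. i < n \<and>
            mat_setdist At (unit_vec n i) (cspan n (unit_vec n ` {j. j < i})) > 0}.
          (mat_setdist At (unit_vec n i) (cspan n (unit_vec n ` S i)))\<^sup>2 /
          (mat_setdist At (unit_vec n i) (cspan n (unit_vec n ` {j. j < i})))\<^sup>2)"
    if "mat_range Ahat = mat_range A"
    using kap that unfolding Ahat by simp
  with optimal show ?thesis by blast
qed

end
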